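(* Let $A$ be a finite set of atoms, let $\ell, r$ be hedges or individual terms and $\nabla$ a freshness context, all $A$-based. Let $X$ be a hedge variable occurring neither in $\ell$, $r$ nor $\nabla$. If $\{X\colon \ell\triangleq r\};\,\emptyset;\,\emptyset;\,id\overset{+}{\Longrightarrow}\emptyset;\,S;\,\Gamma;\,\sigma$ is a derivation (of length at least one) obtained by an execution of the algorithm $\mathsf{VNAU}$ with global parameters $A$ and $\nabla$, then $\langle\Gamma\vdash X\sigma\rangle$ is an $A$-based generalization of $\langle\nabla\vdash\ell\rangle$ and $\langle\nabla\vdash r\rangle$.
   Context: Signature: four pairwise disjoint sets: a countably infinite set of atoms $\mathbf{A}=\{a,b,c,\dots\}$, a countable set of variadic function symbols $\{f,g,h,\dots\}$, a countably infinite set of individual variables $\{x,y,z,\dots\}$ and a countably infinite set of hedge variables $\{X,Y,Z,\dots\}$; $\chi$ denotes a variable of either kind. Permutations $\pi$ of atoms have finite support $\mathrm{supp}(\pi)=\{a\mid \pi(a)\neq a\}$ and are written as finite sequences of swappings $(a\,b)$; $\mathit{Id}$ is the identity. Terms are individual terms $t::= a \mid \pi\cdot x \mid a.t \mid f(\tilde s)$, and hedges $\tilde s ::= r_1,\dots,r_n$ ($n\ge 0$) with $r::=\pi\cdot X\mid t$. Hedges are flat, a singleton hedge is identified with its element, $\varepsilon$ is the empty hedge, $|\tilde s|$ is the length. $\pi\cdot x$, $\pi\cdot X$ are suspensions; $\chi$ abbreviates $\mathit{Id}\cdot\chi$. Permutations act on terms: $(a\,b)\cdot a=b$, $(a\,b)\cdot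 b=a$, $(a\,b)\cdot c=c$ for $c\notin\{a,b\}$, $(a\,b)\cdot(\pi\cdot\chi)=((a\,b)\pi)\cdot\chi$, $(a\,b)\cdot(c.t)=((a\,b)\cdot c).((a\,b)\cdot t)$, $(a\,b)\cdot f(\tilde s)=f((a\,b)\cdot\tilde s)$, componentwise on hedges; a sequence of swappings acts from right to left. Heads: $\mathrm{head}(a)=a$, $\mathrm{head}(\pi\cdot\chi)=\chi$, $\mathrm{head}(a.t)=\text{``.''}$, $\mathrm{head}(f(\tilde s))=f$. Substitutions are finite maps from variables to terms (individual variables to individual terms), identity elsewhere; $id$ is the empty substitution; application: $a\sigma=a$, $(\pi\cdot\chi)\sigma=\pi\cdot(\chi\sigma)$, $(a.t)\sigma=a.(t\sigma)$, $f(\tilde s)\sigma=f(\tilde s\sigma)$, componentwise on hedges. $\sigma\{\chi\mapsto u\}$ is composition of $\sigma$ followed by $\{\chi\mapsto u\}$. A freshness context is a finite set of constraints $a\#\chi$. $\nabla\vdash a\# u$: $\nabla\vdash a\#b$ if $a\ne b$; $\nabla\vdash a\#f(\tilde s)$ if $\nabla\vdash a\#\tilde s$; $\nabla\vdash a\#(r_1,\dots,r_n)$ if $\nabla\vdash a\#r_i$ for all $i$; $\nabla\vdash a\#a.t$; $\nabla\vdash a\#b.t$ if $a\neq b$ and $\nabla\vdash a\#t$; $\nabla\vdash a\#\pi\cdot\chi$ if $(\pi^{-1}\cdot a)\#\chi\in\nabla$. A substitution $\sigma$ respects $\nabla$ if $\nabla\vdash a\#\chi\sigma$ for all $a\#\chi\in\nabla$;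 then $\nabla\sigma$ is the smallest freshness context $\Gamma$ with $\Gamma\vdash a\#\chi\sigma$ for all $a\#\chi\in\nabla$ (also written $\Gamma\{\chi\mapsto u\}$ for a single assignment). The equivalence $\nabla\vdash u\approx u'$: $a\approx a$; $f(\tilde s)\approx f(\tilde q)$ if $\tilde s\approx\tilde q$; hedges of equal length componentwise; $a.t\approx a.t'$ if $t\approx t'$; $a.t\approx b.t'$ if $t\approx (a\,b)\cdot t'$ and $\nabla\vdash a\#b.t'$; $\pi\cdot\chi\approx\pi'\cdot\chi$ if $a\#\chi\in\nabla$ for all $a$ with $\pi\cdot a\neq\pi'\cdot a$. A term-in-context is a pair $\langle\nabla\vdash u\rangle$. $\langle\nabla_1\vdash u_1\rangle$ is more general than $\langle\nabla_2\vdash u_2\rangle$ if there is a substitution $\sigma$ respecting $\nabla_1$ with $\nabla_1\sigma\subseteq\nabla_2$ and $\nabla_2\vdash u_1\sigma\approx u_2$. A generalization of two terms-in-context is a term-in-context more general than both. Something is $A$-based if all atoms occurring in it (including supports of permutations in suspensions, atoms in freshness constraints) belong to $A$. The algorithm $\mathsf{VNAU}$ (global parameters: finite $A\subset\mathbf{A}$ and freshness context $\nabla$) works on states $P;\,S;\,\Gamma;\,\sigma$ with $P$, $S$ sets of anti-unification problems (AUPs) $\chi\colon \ell\triangleq r$, $\Gamma$ a freshness context, $\sigma$ a substitution; it applies the following rules exhaustively in all possible ways. "New" variables occur neither in the state nor in the parameters; $\dot\cup$ is disjoint union. Rules: (Tri-T) $\{X\colon a\triangleq a\}\dot\cup P;S;\Gamma;\sigma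 \Rightarrow P;S;\Gamma;\sigma\{X\mapsto a\}$. (Tri-H) $\{X\colon \varepsilon\triangleq\varepsilon\}\dot\cup P;S;\Gamma;\sigma\Rightarrow P;S;\Gamma;\sigma\{X\mapsto\varepsilon\}$. (Dec-T) $\{X\colon f(\tilde s)\triangleq f(\tilde q)\}\dot\cup P;S;\Gamma;\sigma\Rightarrow\{Y\colon\tilde s\triangleq\tilde q\}\cup P;S;\Gamma;\sigma\{X\mapsto f(Y)\}$, $Y$ a new hedge variable. (Dec-H) $\{X\colon \tilde s_1,\tilde s_2\triangleq\tilde q_1,\tilde q_2\}\dot\cup P;S;\Gamma;\sigma\Rightarrow\{Y_1\colon\tilde s_1\triangleq\tilde q_1, Y_2\colon\tilde s_2\triangleq\tilde q_2\}\cup P;S;\Gamma;\sigma\{X\mapsto Y_1,Y_2\}$, where $|\tilde s_1,\tilde q_1|=1$ or $|\tilde s_1|=|\tilde q_1|=1$, $|\tilde s_2,\tilde q_2|\ge 1$, $Y_1,Y_2$ new hedge variables. (Abs-T) $\{X\colon a.t_1\triangleq b.t_2\}\dot\cup P;S;\Gamma;\sigma\Rightarrow\{Y\colon (c\,a)\cdot t_1\triangleq (c\,b)\cdot t_2\}\cup P;S;\Gamma;\sigma\{X\mapsto c.Y\}$, where $c\in A$, $Y$ new hedge variable, $\nabla\vdash c\#a.t_1$ and $\nabla\vdash c\#b.t_2$. (Sol-T) $\{X\colon r_1\triangleq r_2\}\dot\cup P;S;\Gamma;\sigma\Rightarrow P;\{X\colon r_1\triangleq r_2\}\cup S;\{a\#X\mid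 a\in A,\nabla\vdash a\#r_1,\nabla\vdash a\#r_2\}\cup\Gamma;\sigma$, where $r_1,r_2$ are suspensions or $\mathrm{head}(r_1)\ne\mathrm{head}(r_2)$. (Sol-H) $\{X\colon \tilde s\triangleq\tilde q\}\dot\cup P;S;\Gamma;\sigma\Rightarrow P;\{X\colon\tilde s\triangleq\tilde q\}\cup S;\{a\#X\mid a\in A,\nabla\vdash a\#\tilde s,\nabla\vdash a\#\tilde q\}\cup\Gamma;\sigma$, where $|\tilde s,\tilde q|=1$. (Mer) $P;\{\chi_1\colon\ell_1\triangleq r_1,\chi_2\colon\ell_2\triangleq r_2\}\dot\cup S;\Gamma;\sigma\Rightarrow P;\{\chi_1\colon\ell_1\triangleq r_1\}\cup S;\Gamma\{\chi_2\mapsto\pi\cdot\chi_1\};\sigma\{\chi_2\mapsto\pi\cdot\chi_1\}$, where $\pi$ is an $A$-based permutation with $\nabla\vdash\pi\cdot\ell_1\approx\ell_2$ and $\nabla\vdash\pi\cdot r_1\approx r_2$. (Nar-T) $P;\{X\colon t_1\triangleq t_2\}\dot\cup S;\Gamma;\sigma\Rightarrow P;\{x\colon t_1\triangleq t_2\}\cup S;\Gamma\{X\mapsto x\};\sigma\{X\mapsto x\}$ ($t_1,t_2$ individual terms, $x$ new individual variable).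
   Formalization: "σ respects ∇" is read as: some freshness context derives all a#χσ with a#χ in ∇ (under ∇ itself the claim fails); abstraction bodies in Xσ may be hedges, since Abs-T and Dec-H can produce c.(Y1,Y2), while ℓ, r and the witnessing substitutions stay in the stated grammar. *)

theory Defs
  imports
    "HOL-Library.Countable"
    "HOL-Library.Infinite_Typeclass"
    "HOL-Combinatorics.Perm"
begin

section \<open>Terms and hedges\<close>

text \<open>
  The four disjoint components of the signature are type parameters: atoms \<open>'a\<close>, function
  symbols \<open>'f\<close>, individual variables \<open>'v\<close> and hedge variables \<open>'w\<close>. Finitely supported
  permutations of atoms are the type \<open>'a perm\<close>, whose product is composition
  (the right factor acts first) and in which \<open>affected \<pi>\<close> is the support of \<open>\<pi>\<close>.
\<close>

datatype ('v, 'w) var = IVar 'v | HVar 'w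

text \<open>
  Hedges are lists, hence flat. An individual term \<open>t\<close> is identified with the singleton
  hedge \<open>[Term t]\<close>, so \<open>hedge\<close> also serves as the type of "individual terms or hedges".

  The body of an abstraction is a hedge in this datatype. In the actual term language it is an
  individual term; this is expressed by \<open>proper_trm\<close> below. The larger syntax is needed because the
  algorithm builds abstractions \<open>c.Y\<close> over a hedge variable \<open>Y\<close>, which it may then instantiate by
  a hedge of length other than one. All operations are extended to such expressions componentwise.
\<close>

datatype ('a, 'f, 'v, 'w) trm =
    Atom 'a
  | ISusp "'a perm" 'v
  | Abs 'a "('a, 'f, 'v, 'w) elem list"
  | App 'f "('a, 'f, 'v, 'w) elem list"
and ('a, 'f, 'v, 'w) elem =
    HSusp "'a perm" 'w
  | Term "('a, 'f, 'v, 'w) trm"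

type_synonym ('a, 'f, 'v, 'w) hedge = "('a, 'f, 'v, 'w) elem list"

inductive proper_trm :: "('a, 'f, 'v, 'w) trm \<Rightarrow> bool"
  and proper_elem :: "('a, 'f, 'v, 'w) elem \<Rightarrow> bool" where
  "proper_trm (Atom a)"
| "proper_trm (ISusp \<pi> x)"
| "proper_trm t \<Longrightarrow> proper_trm (Abs a [Term t])"
| "\<forall>r\<in>set s. proper_elem r \<Longrightarrow> proper_trm (App f s)"
| "proper_elem (HSusp \<pi> X)"
| "proper_trm t \<Longrightarrow> proper_elem (Term t)"

definition proper_hedge :: "('a, 'f, 'v, 'w) hedge \<Rightarrow> bool" where
  "proper_hedge s \<longleftrightarrow> (\<forall>r\<in>set s. proper_elem r)"

fun susp :: "'a perm \<Rightarrow> ('v, 'w) var \<Rightarrow> ('a, 'f, 'v, 'w) hedge" where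
  "susp \<pi> (IVar x) = [Term (ISusp \<pi> x)]"
| "susp \<pi> (HVar X) = [HSusp \<pi> X]"

primrec perm_trm :: "'a perm \<Rightarrow> ('a, 'f, 'v, 'w) trm \<Rightarrow> ('a, 'f, 'v, 'w) trm"
  and perm_elem :: "'a perm \<Rightarrow> ('a, 'f, 'v, 'w) elem \<Rightarrow> ('a, 'f, 'v, 'w) elem" where
  "perm_trm \<pi> (Atom a) = Atom (Perm.apply \<pi> a)"
| "perm_trm \<pi> (ISusp \<pi>' x) = ISusp (\<pi> * \<pi>') x"
| "perm_trm \<pi> (Abs a s) = Abs (Perm.apply \<pi> a) (map (perm_elem \<pi>) s)"
| "perm_trm \<pi> (App f s) = App f (map (perm_elem \<pi>) s)"
| "perm_elem \<pi> (HSusp \<pi>' X) = HSusp (\<pi> * \<pi>') X"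
| "perm_elem \<pi> (Term t) = Term (perm_trm \<pi> t)"

definition perm_hedge :: "'a perm \<Rightarrow> ('a, 'f, 'v, 'w) hedge \<Rightarrow> ('a, 'f, 'v, 'w) hedge" where
  "perm_hedge \<pi> s = map (perm_elem \<pi>) s"

primrec atoms_trm :: "('a, 'f, 'v, 'w) trm \<Rightarrow> 'a set"
  and atoms_elem :: "('a, 'f, 'v, 'w) elem \<Rightarrow> 'a set" where
  "atoms_trm (Atom a) = {a}"
| "atoms_trm (ISusp \<pi> x) = affected \<pi>"
| "atoms_trm (Abs a s) = insert a (\<Union> (set (map atoms_elem s)))"
| "atoms_trm (App f s) = \<Union> (set (map atoms_elem s))"
| "atoms_elem (HSusp \<pi> X) = affected \<pi>"
| "atoms_elem (Term t) = atoms_trm t"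

definition atoms_hedge :: "('a, 'f, 'v, 'w) hedge \<Rightarrow> 'a set" where
  "atoms_hedge s = (\<Union>r\<in>set s. atoms_elem r)"

primrec vars_trm :: "('a, 'f, 'v, 'w) trm \<Rightarrow> ('v, 'w) var set"
  and vars_elem :: "('a, 'f, 'v, 'w) elem \<Rightarrow> ('v, 'w) var set" where
  "vars_trm (Atom a) = {}"
| "vars_trm (ISusp \<pi> x) = {IVar x}"
| "vars_trm (Abs a s) = \<Union> (set (map vars_elem s))"
| "vars_trm (App f s) = \<Union> (set (map vars_elem s))"
| "vars_elem (HSusp \<pi> X) = {HVar X}"
| "vars_elem (Term t) = vars_trm t"

definition vars_hedge :: "('a, 'f, 'v, 'w) hedge \<Rightarrow> ('v, 'w) var set" where
  "vars_hedge s = (\<Union>r\<in>set s. vars_elem r)"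

datatype ('a, 'f, 'v, 'w) head_symbol =
  AtomHead 'a | VarHead "('v, 'w) var" | AbsHead | FunHead 'f

fun head :: "('a, 'f, 'v, 'w) elem \<Rightarrow> ('a, 'f, 'v, 'w) head_symbol" where
  "head (Term (Atom a)) = AtomHead a"
| "head (Term (ISusp \<pi> x)) = VarHead (IVar x)"
| "head (Term (Abs a s)) = AbsHead"
| "head (Term (App f s)) = FunHead f"
| "head (HSusp \<pi> X) = VarHead (HVar X)"

definition is_suspension :: "('a, 'f, 'v, 'w) elem \<Rightarrow> bool" where
  "is_suspension r \<longleftrightarrow> (\<exists>\<pi> x. r = Term (ISusp \<pi> x)) \<or> (\<exists>\<pi> X. r = HSusp \<pi> X)"


section \<open>Substitutions\<close>

text \<open>
  An assignment consists of total functions on the individual and on the hedge variables.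
  \<open>is_subst\<close> singles out the substitutions: the domain is finite and the values are proper.
  (The assignments computed by the algorithm have finite domain, but may contain
  improper abstractions \<open>c.Y\<close>.)
\<close>

type_synonym ('a, 'f, 'v, 'w) subst =
  "('v \<Rightarrow> ('a, 'f, 'v, 'w) trm) \<times> ('w \<Rightarrow> ('a, 'f, 'v, 'w) hedge)"

fun subst_var :: "('a, 'f, 'v, 'w) subst \<Rightarrow> ('v, 'w) var \<Rightarrow> ('a, 'f, 'v, 'w) hedge" where
  "subst_var \<sigma> (IVar x) = [Term (fst \<sigma> x)]"
| "subst_var \<sigma> (HVar X) = snd \<sigma> X"

text \<open>Applying a substitution to a hedge element yields a hedge, which is spliced in.\<close>

primrec subst_trm :: "('a, 'f, 'v, 'w) subst \<Rightarrow> ('a, 'f, 'v, 'w) trm \<Rightarrow> ('a, 'f, 'v, 'w) trm"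
  and subst_elem :: "('a, 'f, 'v, 'w) subst \<Rightarrow> ('a, 'f, 'v, 'w) elem \<Rightarrow> ('a, 'f, 'v, 'w) hedge" where
  "subst_trm \<sigma> (Atom a) = Atom a"
| "subst_trm \<sigma> (ISusp \<pi> x) = perm_trm \<pi> (fst \<sigma> x)"
| "subst_trm \<sigma> (Abs a s) = Abs a (concat (map (subst_elem \<sigma>) s))"
| "subst_trm \<sigma> (App f s) = App f (concat (map (subst_elem \<sigma>) s))"
| "subst_elem \<sigma> (HSusp \<pi> X) = perm_hedge \<pi> (snd \<sigma> X)"
| "subst_elem \<sigma> (Term t) = [Term (subst_trm \<sigma> t)]"

definition subst_hedge ::
  "('a, 'f, 'v, 'w) subst \<Rightarrow> ('a, 'f, 'v, 'w) hedge \<Rightarrow> ('a, 'f, 'v, 'w) hedge" where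
  "subst_hedge \<sigma> s = concat (map (subst_elem \<sigma>) s)"

definition subst_id :: "('a, 'f, 'v, 'w) subst" where
  "subst_id = ((\<lambda>x. ISusp 1 x), (\<lambda>X. [HSusp 1 X]))"

definition subst_dom :: "('a, 'f, 'v, 'w) subst \<Rightarrow> ('v, 'w) var set" where
  "subst_dom \<sigma> = {\<chi>. subst_var \<sigma> \<chi> \<noteq> susp 1 \<chi>}"

definition is_subst :: "('a, 'f, 'v, 'w) subst \<Rightarrow> bool" where
  "is_subst \<sigma> \<longleftrightarrow> finite (subst_dom \<sigma>) \<and> (\<forall>\<chi>. proper_hedge (subst_var \<sigma> \<chi>))"

definition vars_subst :: "('a, 'f, 'v, 'w) subst \<Rightarrow> ('v, 'w) var set" where
  "vars_subst \<sigma> = subst_dom \<sigma> \<union> (\<Union>\<chi>\<in>subst_dom \<sigma>. vars_hedge (subst_var \<sigma> \<chi>))"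

text \<open>\<open>subst_comp \<sigma> \<tau>\<close> is \<open>\<sigma>\<close> followed by \<open>\<tau>\<close>.\<close>

definition subst_comp ::
  "('a, 'f, 'v, 'w) subst \<Rightarrow> ('a, 'f, 'v, 'w) subst \<Rightarrow> ('a, 'f, 'v, 'w) subst" where
  "subst_comp \<sigma> \<tau> = ((\<lambda>x. subst_trm \<tau> (fst \<sigma> x)), (\<lambda>X. subst_hedge \<tau> (snd \<sigma> X)))"

definition isingle :: "'v \<Rightarrow> ('a, 'f, 'v, 'w) trm \<Rightarrow> ('a, 'f, 'v, 'w) subst" where
  "isingle x t = ((fst subst_id)(x := t), snd subst_id)"

definition hsingle :: "'w \<Rightarrow> ('a, 'f, 'v, 'w) hedge \<Rightarrow> ('a, 'f, 'v, 'w) subst" where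
  "hsingle X s = (fst subst_id, (snd subst_id)(X := s))"


section \<open>Freshness and equivalence\<close>

text \<open>The pair \<open>(a, \<chi>)\<close> stands for the constraint \<open>a # \<chi>\<close>; freshness contexts are the finite sets.\<close>

type_synonym ('a, 'v, 'w) fctx = "('a \<times> ('v, 'w) var) set"

inductive fresh_trm :: "('a, 'v, 'w) fctx \<Rightarrow> 'a \<Rightarrow> ('a, 'f, 'v, 'w) trm \<Rightarrow> bool"
  and fresh_elem :: "('a, 'v, 'w) fctx \<Rightarrow> 'a \<Rightarrow> ('a, 'f, 'v, 'w) elem \<Rightarrow> bool"
  for \<Delta> :: "('a, 'v, 'w) fctx" where
  fresh_Atom: "a \<noteq> b \<Longrightarrow> fresh_trm \<Delta> a (Atom b)"
| fresh_App: "\<forall>r\<in>set s. fresh_elem \<Delta> a r \<Longrightarrow> fresh_trm \<Delta> a (App f s)"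
| fresh_Abs_same: "fresh_trm \<Delta> a (Abs a s)"
| fresh_Abs_diff: "a \<noteq> b \<Longrightarrow> \<forall>r\<in>set s. fresh_elem \<Delta> a r \<Longrightarrow> fresh_trm \<Delta> a (Abs b s)"
| fresh_ISusp: "(Perm.apply (inverse \<pi>) a, IVar x) \<in> \<Delta> \<Longrightarrow> fresh_trm \<Delta> a (ISusp \<pi> x)"
| fresh_HSusp: "(Perm.apply (inverse \<pi>) a, HVar X) \<in> \<Delta> \<Longrightarrow> fresh_elem \<Delta> a (HSusp \<pi> X)"
| fresh_Term: "fresh_trm \<Delta> a t \<Longrightarrow> fresh_elem \<Delta> a (Term t)"

definition fresh_hedge :: "('a, 'v, 'w) fctx \<Rightarrow> 'a \<Rightarrow> ('a, 'f, 'v, 'w) hedge \<Rightarrow> bool" where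
  "fresh_hedge \<Delta> a s \<longleftrightarrow> (\<forall>r\<in>set s. fresh_elem \<Delta> a r)"

inductive equiv_trm ::
    "('a, 'v, 'w) fctx \<Rightarrow> ('a, 'f, 'v, 'w) trm \<Rightarrow> ('a, 'f, 'v, 'w) trm \<Rightarrow> bool"
  and equiv_elem ::
    "('a, 'v, 'w) fctx \<Rightarrow> ('a, 'f, 'v, 'w) elem \<Rightarrow> ('a, 'f, 'v, 'w) elem \<Rightarrow> bool"
  for \<Delta> :: "('a, 'v, 'w) fctx" where
  equiv_Atom: "equiv_trm \<Delta> (Atom a) (Atom a)"
| equiv_App: "list_all2 (equiv_elem \<Delta>) s q \<Longrightarrow> equiv_trm \<Delta> (App f s) (App f q)"
| equiv_Abs_same: "list_all2 (equiv_elem \<Delta>) s q \<Longrightarrow> equiv_trm \<Delta> (Abs a s) (Abs a q)"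
| equiv_Abs_diff: "list_all2 (equiv_elem \<Delta>) s (perm_hedge (Perm.swap a b) q) \<Longrightarrow>
    fresh_trm \<Delta> a (Abs b q) \<Longrightarrow> equiv_trm \<Delta> (Abs a s) (Abs b q)"
| equiv_ISusp: "\<forall>a. Perm.apply \<pi> a \<noteq> Perm.apply \<pi>' a \<longrightarrow> (a, IVar x) \<in> \<Delta> \<Longrightarrow>
    equiv_trm \<Delta> (ISusp \<pi> x) (ISusp \<pi>' x)"
| equiv_HSusp: "\<forall>a. Perm.apply \<pi> a \<noteq> Perm.apply \<pi>' a \<longrightarrow> (a, HVar X) \<in> \<Delta> \<Longrightarrow>
    equiv_elem \<Delta> (HSusp \<pi> X) (HSusp \<pi>' X)"
| equiv_Term: "equiv_trm \<Delta> t t' \<Longrightarrow> equiv_elem \<Delta> (Term t) (Term t')"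

definition equiv_hedge ::
  "('a, 'v, 'w) fctx \<Rightarrow> ('a, 'f, 'v, 'w) hedge \<Rightarrow> ('a, 'f, 'v, 'w) hedge \<Rightarrow> bool" where
  "equiv_hedge \<Delta> s q \<longleftrightarrow> list_all2 (equiv_elem \<Delta>) s q"

definition atoms_ctx :: "('a, 'v, 'w) fctx \<Rightarrow> 'a set" where
  "atoms_ctx \<Delta> = fst ` \<Delta>"

definition vars_ctx :: "('a, 'v, 'w) fctx \<Rightarrow> ('v, 'w) var set" where
  "vars_ctx \<Delta> = snd ` \<Delta>"

definition satisfies_under ::
  "('a, 'v, 'w) fctx \<Rightarrow> ('a, 'v, 'w) fctx \<Rightarrow> ('a, 'f, 'v, 'w) subst \<Rightarrow> bool" where
  "satisfies_under \<Gamma> \<Delta> \<sigma> \<longleftrightarrow> (\<forall>(a, \<chi>)\<in>\<Delta>. fresh_hedge \<Gamma> a (subst_var \<sigma> \<chi>))"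

text \<open>
  A substitution respects \<open>\<Delta>\<close> if the instantiated constraints hold under some freshness
  context, i.e. if there is a context as required in the definition of \<open>\<Delta>\<sigma>\<close>. Requiring them to
  hold under \<open>\<Delta>\<close> itself would be too strong: even a renaming \<open>{X \<mapsto> Y}\<close> would not respect
  \<open>{a # X}\<close>, so that e.g. \<open>\<langle>{a # X} \<turnstile> X\<rangle>\<close> would not be more general than \<open>\<langle>{a # Y} \<turnstile> Y\<rangle>\<close>.
\<close>

definition respects_ctx :: "('a, 'f, 'v, 'w) subst \<Rightarrow> ('a, 'v, 'w) fctx \<Rightarrow> bool" where
  "respects_ctx \<sigma> \<Delta> \<longleftrightarrow> (\<exists>\<Gamma>. finite \<Gamma> \<and> satisfies_under \<Gamma> \<Delta> \<sigma>)"

text \<open>\<open>\<Delta>\<sigma>\<close>, the least context with respect to inclusion; meaningful if \<open>\<sigma>\<close> respects \<open>\<Delta>\<close>.\<close>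

definition subst_ctx ::
  "('a, 'v, 'w) fctx \<Rightarrow> ('a, 'f, 'v, 'w) subst \<Rightarrow> ('a, 'v, 'w) fctx" where
  "subst_ctx \<Delta> \<sigma> = (LEAST \<Gamma>. finite \<Gamma> \<and> satisfies_under \<Gamma> \<Delta> \<sigma>)"


section \<open>Terms-in-context and generalizations\<close>

type_synonym ('a, 'f, 'v, 'w) tic = "('a, 'v, 'w) fctx \<times> ('a, 'f, 'v, 'w) hedge"

definition is_tic :: "('a, 'f, 'v, 'w) tic \<Rightarrow> bool" where
  "is_tic p \<longleftrightarrow> finite (fst p)"

definition more_general :: "('a, 'f, 'v, 'w) tic \<Rightarrow> ('a, 'f, 'v, 'w) tic \<Rightarrow> bool" where
  "more_general p\<^sub>1 p\<^sub>2 \<longleftrightarrow>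
    (\<exists>\<sigma>. is_subst \<sigma> \<and> respects_ctx \<sigma> (fst p\<^sub>1) \<and> subst_ctx (fst p\<^sub>1) \<sigma> \<subseteq> fst p\<^sub>2 \<and>
      equiv_hedge (fst p\<^sub>2) (subst_hedge \<sigma> (snd p\<^sub>1)) (snd p\<^sub>2))"

definition is_generalization ::
  "('a, 'f, 'v, 'w) tic \<Rightarrow> ('a, 'f, 'v, 'w) tic \<Rightarrow> ('a, 'f, 'v, 'w) tic \<Rightarrow> bool" where
  "is_generalization g p\<^sub>1 p\<^sub>2 \<longleftrightarrow> is_tic g \<and> more_general g p\<^sub>1 \<and> more_general g p\<^sub>2"

definition based_perm :: "'a set \<Rightarrow> 'a perm \<Rightarrow> bool" where
  "based_perm A \<pi> \<longleftrightarrow> affected \<pi> \<subseteq> A"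

definition based_hedge :: "'a set \<Rightarrow> ('a, 'f, 'v, 'w) hedge \<Rightarrow> bool" where
  "based_hedge A s \<longleftrightarrow> atoms_hedge s \<subseteq> A"

definition based_ctx :: "'a set \<Rightarrow> ('a, 'v, 'w) fctx \<Rightarrow> bool" where
  "based_ctx A \<Delta> \<longleftrightarrow> atoms_ctx \<Delta> \<subseteq> A"

definition based_tic :: "'a set \<Rightarrow> ('a, 'f, 'v, 'w) tic \<Rightarrow> bool" where
  "based_tic A p \<longleftrightarrow> based_ctx A (fst p) \<and> based_hedge A (snd p)"


section \<open>The algorithm\<close>

text \<open>The triple \<open>(\<chi>, l, r)\<close> stands for the anti-unification problem with generalization
  variable \<open>\<chi>\<close> and sides \<open>l\<close>, \<open>r\<close>.\<close>

type_synonym ('a, 'f, 'v, 'w) aup =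
  "('v, 'w) var \<times> ('a, 'f, 'v, 'w) hedge \<times> ('a, 'f, 'v, 'w) hedge"

type_synonym ('a, 'f, 'v, 'w) state =
  "('a, 'f, 'v, 'w) aup set \<times> ('a, 'f, 'v, 'w) aup set \<times>
   ('a, 'v, 'w) fctx \<times> ('a, 'f, 'v, 'w) subst"

definition vars_aups :: "('a, 'f, 'v, 'w) aup set \<Rightarrow> ('v, 'w) var set" where
  "vars_aups P = (\<Union>(\<chi>, l, r)\<in>P. {\<chi>} \<union> vars_hedge l \<union> vars_hedge r)"

definition new_var :: "('a, 'v, 'w) fctx \<Rightarrow> ('a, 'f, 'v, 'w) state \<Rightarrow> ('v, 'w) var \<Rightarrow> bool" where
  "new_var \<Delta> st \<chi> \<longleftrightarrow> (case st of (P, S, \<Gamma>, \<sigma>) \<Rightarrow>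
    \<chi> \<notin> vars_aups P \<union> vars_aups S \<union> vars_ctx \<Gamma> \<union> vars_subst \<sigma> \<union> vars_ctx \<Delta>)"

definition common_fresh ::
  "'a set \<Rightarrow> ('a, 'v, 'w) fctx \<Rightarrow> ('v, 'w) var \<Rightarrow>
   ('a, 'f, 'v, 'w) hedge \<Rightarrow> ('a, 'f, 'v, 'w) hedge \<Rightarrow> ('a, 'v, 'w) fctx" where
  "common_fresh A \<Delta> \<chi> l r = {(a, \<chi>) |a. a \<in> A \<and> fresh_hedge \<Delta> a l \<and> fresh_hedge \<Delta> a r}"

text \<open>
  Disjoint unions \<open>{p} \<union> P\<close> on the left of a rule are rendered by \<open>insert p P\<close> with \<open>p \<notin> P\<close>.
  The merging rule is split according to the kind of the variable \<open>\<chi>\<^sub>2\<close> that is eliminated: an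
  individual variable can only be mapped to an individual term, so it can only be replaced by a
  suspension of an individual variable, whereas a hedge variable can be replaced by a suspension
  of either kind.
\<close>

inductive vnau ::
  "'a set \<Rightarrow> ('a, 'v, 'w) fctx \<Rightarrow> ('a, 'f, 'v, 'w) state \<Rightarrow> ('a, 'f, 'v, 'w) state \<Rightarrow> bool"
  for A :: "'a set" and \<Delta> :: "('a, 'v, 'w) fctx" where
  Tri_T:
    "(HVar X, [Term (Atom a)], [Term (Atom a)]) \<notin> P \<Longrightarrow>
     vnau A \<Delta> (insert (HVar X, [Term (Atom a)], [Term (Atom a)]) P, S, \<Gamma>, \<sigma>)
       (P, S, \<Gamma>, subst_comp \<sigma> (hsingle X [Term (Atom a)]))"
| Tri_H:
    "(HVar X, [], []) \<notin> P \<Longrightarrow>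
     vnau A \<Delta> (insert (HVar X, [], []) P, S, \<Gamma>, \<sigma>)
       (P, S, \<Gamma>, subst_comp \<sigma> (hsingle X []))"
| Dec_T:
    "st = (insert (HVar X, [Term (App f s)], [Term (App f q)]) P, S, \<Gamma>, \<sigma>) \<Longrightarrow>
     (HVar X, [Term (App f s)], [Term (App f q)]) \<notin> P \<Longrightarrow>
     new_var \<Delta> st (HVar Y) \<Longrightarrow>
     vnau A \<Delta> st
       ({(HVar Y, s, q)} \<union> P, S, \<Gamma>, subst_comp \<sigma> (hsingle X [Term (App f [HSusp 1 Y])]))"
| Dec_H:
    "st = (insert (HVar X, s\<^sub>1 @ s\<^sub>2, q\<^sub>1 @ q\<^sub>2) P, S, \<Gamma>, \<sigma>) \<Longrightarrow>
     (HVar X, s\<^sub>1 @ s\<^sub>2, q\<^sub>1 @ q\<^sub>2) \<notin> P \<Longrightarrow>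
     length (s\<^sub>1 @ q\<^sub>1) = 1 \<or> (length s\<^sub>1 = 1 \<and> length q\<^sub>1 = 1) \<Longrightarrow>
     length (s\<^sub>2 @ q\<^sub>2) \<ge> 1 \<Longrightarrow>
     new_var \<Delta> st (HVar Y\<^sub>1) \<Longrightarrow> new_var \<Delta> st (HVar Y\<^sub>2) \<Longrightarrow> Y\<^sub>1 \<noteq> Y\<^sub>2 \<Longrightarrow>
     vnau A \<Delta> st
       ({(HVar Y\<^sub>1, s\<^sub>1, q\<^sub>1), (HVar Y\<^sub>2, s\<^sub>2, q\<^sub>2)} \<union> P, S, \<Gamma>,
        subst_comp \<sigma> (hsingle X [HSusp 1 Y\<^sub>1, HSusp 1 Y\<^sub>2]))"
| Abs_T:
    "st = (insert (HVar X, [Term (Abs a [Term t\<^sub>1])], [Term (Abs b [Term t\<^sub>2])]) P, S, \<Gamma>, \<sigma>) \<Longrightarrow>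
     (HVar X, [Term (Abs a [Term t\<^sub>1])], [Term (Abs b [Term t\<^sub>2])]) \<notin> P \<Longrightarrow>
     c \<in> A \<Longrightarrow> fresh_trm \<Delta> c (Abs a [Term t\<^sub>1]) \<Longrightarrow> fresh_trm \<Delta> c (Abs b [Term t\<^sub>2]) \<Longrightarrow>
     new_var \<Delta> st (HVar Y) \<Longrightarrow>
     vnau A \<Delta> st
       ({(HVar Y, [Term (perm_trm (Perm.swap c a) t\<^sub>1)], [Term (perm_trm (Perm.swap c b) t\<^sub>2)])} \<union> P,
        S, \<Gamma>, subst_comp \<sigma> (hsingle X [Term (Abs c [HSusp 1 Y])]))"
| Sol_T:
    "(HVar X, [r\<^sub>1], [r\<^sub>2]) \<notin> P \<Longrightarrow>
     (is_suspension r\<^sub>1 \<and> is_suspension r\<^sub>2) \<or> head r\<^sub>1 \<noteq> head r\<^sub>2 \<Longrightarrow>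
     vnau A \<Delta> (insert (HVar X, [r\<^sub>1], [r\<^sub>2]) P, S, \<Gamma>, \<sigma>)
       (P, {(HVar X, [r\<^sub>1], [r\<^sub>2])} \<union> S, common_fresh A \<Delta> (HVar X) [r\<^sub>1] [r\<^sub>2] \<union> \<Gamma>, \<sigma>)"
| Sol_H:
    "(HVar X, s, q) \<notin> P \<Longrightarrow>
     length (s @ q) = 1 \<Longrightarrow>
     vnau A \<Delta> (insert (HVar X, s, q) P, S, \<Gamma>, \<sigma>)
       (P, {(HVar X, s, q)} \<union> S, common_fresh A \<Delta> (HVar X) s q \<union> \<Gamma>, \<sigma>)"
| Mer_I:
    "(IVar x\<^sub>1, l\<^sub>1, r\<^sub>1) \<notin> S \<Longrightarrow> (IVar x\<^sub>2, l\<^sub>2, r\<^sub>2) \<notin> S \<Longrightarrow>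
     (x\<^sub>1, l\<^sub>1, r\<^sub>1) \<noteq> (x\<^sub>2, l\<^sub>2, r\<^sub>2) \<Longrightarrow>
     based_perm A \<pi> \<Longrightarrow>
     equiv_hedge \<Delta> (perm_hedge \<pi> l\<^sub>1) l\<^sub>2 \<Longrightarrow> equiv_hedge \<Delta> (perm_hedge \<pi> r\<^sub>1) r\<^sub>2 \<Longrightarrow>
     \<tau> = isingle x\<^sub>2 (ISusp \<pi> x\<^sub>1) \<Longrightarrow>
     vnau A \<Delta> (P, {(IVar x\<^sub>1, l\<^sub>1, r\<^sub>1), (IVar x\<^sub>2, l\<^sub>2, r\<^sub>2)} \<union> S, \<Gamma>, \<sigma>)
       (P, {(IVar x\<^sub>1, l\<^sub>1, r\<^sub>1)} \<union> S, subst_ctx \<Gamma> \<tau>, subst_comp \<sigma> \<tau>)"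
| Mer_H:
    "(\<chi>\<^sub>1, l\<^sub>1, r\<^sub>1) \<notin> S \<Longrightarrow> (HVar X\<^sub>2, l\<^sub>2, r\<^sub>2) \<notin> S \<Longrightarrow>
     (\<chi>\<^sub>1, l\<^sub>1, r\<^sub>1) \<noteq> (HVar X\<^sub>2, l\<^sub>2, r\<^sub>2) \<Longrightarrow>
     based_perm A \<pi> \<Longrightarrow>
     equiv_hedge \<Delta> (perm_hedge \<pi> l\<^sub>1) l\<^sub>2 \<Longrightarrow> equiv_hedge \<Delta> (perm_hedge \<pi> r\<^sub>1) r\<^sub>2 \<Longrightarrow>
     \<tau> = hsingle X\<^sub>2 (susp \<pi> \<chi>\<^sub>1) \<Longrightarrow>
     vnau A \<Delta> (P, {(\<chi>\<^sub>1, l\<^sub>1, r\<^sub>1), (HVar X\<^sub>2, l\<^sub>2, r\<^sub>2)} \<union> S, \<Gamma>, \<sigma>)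
       (P, {(\<chi>\<^sub>1, l\<^sub>1, r\<^sub>1)} \<union> S, subst_ctx \<Gamma> \<tau>, subst_comp \<sigma> \<tau>)"
| Nar_T:
    "st = (P, insert (HVar X, [Term t\<^sub>1], [Term t\<^sub>2]) S, \<Gamma>, \<sigma>) \<Longrightarrow>
     (HVar X, [Term t\<^sub>1], [Term t\<^sub>2]) \<notin> S \<Longrightarrow>
     new_var \<Delta> st (IVar x) \<Longrightarrow>
     \<tau> = hsingle X [Term (ISusp 1 x)] \<Longrightarrow>
     vnau A \<Delta> st
       (P, {(IVar x, [Term t\<^sub>1], [Term t\<^sub>2])} \<union> S, subst_ctx \<Gamma> \<tau>, subst_comp \<sigma> \<tau>)"

end

theory Submission
  imports Defs
begin

text \<open>
  Call a substitution a left match of a state if it sends the variable of every anti-unification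
  problem in \<open>P \<union> S\<close> to a hedge equivalent to the left side of that problem. The invariant is that
  every left match maps \<open>X\<sigma>\<close> to a hedge equivalent to \<open>l\<close> and satisfies \<open>\<Gamma>\<close>, and likewise on the
  right. Each step composes \<open>\<sigma>\<close> with a substitution \<open>\<tau>\<close> such that \<open>\<tau>\<close> followed by a match of the new
  state is a match of the old one, so the invariant is preserved. Matches are taken up to equivalence
  because (Mer) replaces a problem by one that is only equivalent to it up to a permutation; composing
  several mergings then needs transitivity of the equivalence. When \<open>P\<close> is empty, mapping each
  variable of \<open>S\<close> to the left (right) side of its problem is a match.
\<close>

section \<open>Permutations and substitutions\<close>

lemma apply_inverse_apply [simp]:
  "Perm.apply (inverse \<pi>) (Perm.apply \<pi> a) = a"
  "Perm.apply \<pi> (Perm.apply (inverse \<pi>) a) = a"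
  by (simp_all add: apply_inverse bij_is_inj bij_is_surj surj_f_inv_f)

lemma apply_eq_iff_inverse: "Perm.apply \<pi> a = b \<longleftrightarrow> a = Perm.apply (inverse \<pi>) b"
  by auto

lemma apply_swap: "Perm.apply (Perm.swap a b) c = (if c = a then b else if c = b then a else c)"
  by auto

text \<open>The conjugation law for transpositions. It moves a permutation past the swapping that
  compares two abstractions, as needed in \<open>equiv_perm\<close>.\<close>

lemma swap_conj: "\<pi> * Perm.swap a b = Perm.swap (Perm.apply \<pi> a) (Perm.apply \<pi> b) * \<pi>"
  by (rule perm_eqI) (auto simp: apply_times apply_swap apply_inj)

lemma affected_times_subset:
  "affected \<pi> \<subseteq> A \<Longrightarrow> affected \<rho> \<subseteq> A \<Longrightarrow> affected (\<pi> * \<rho>) \<subseteq> A"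
  by (rule order_trans[OF affected_times]) simp

lemma affected_swap_subset: "a \<in> A \<Longrightarrow> b \<in> A \<Longrightarrow> affected (Perm.swap a b) \<subseteq> A"
  by (cases "a = b") (auto simp: affected_swap)

lemma apply_closed:
  assumes "affected \<pi> \<subseteq> A" "a \<in> A" shows "Perm.apply \<pi> a \<in> A"
proof (cases "a \<in> affected \<pi>")
  case True
  then have "Perm.apply \<pi> a \<in> affected \<pi>" by simp
  with assms(1) show ?thesis by blast
qed (use assms(2) in \<open>simp add: in_affected\<close>)

lemma perm_hedge_simps [simp]:
  "perm_hedge \<pi> [] = []"
  "perm_hedge \<pi> (e # s) = perm_elem \<pi> e # perm_hedge \<pi> s"
  "perm_hedge \<pi> (s @ q) = perm_hedge \<pi> s @ perm_hedge \<pi> q"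
  by (simp_all add: perm_hedge_def)

lemma subst_hedge_simps [simp]:
  "subst_hedge \<sigma> [] = []"
  "subst_hedge \<sigma> (e # s) = subst_elem \<sigma> e @ subst_hedge \<sigma> s"
  "subst_hedge \<sigma> (s @ q) = subst_hedge \<sigma> s @ subst_hedge \<sigma> q"
  by (simp_all add: subst_hedge_def)

lemma perm_times:
  fixes t :: "('a, 'f, 'v, 'w) trm" and e :: "('a, 'f, 'v, 'w) elem"
  shows "perm_trm (\<pi> * \<rho>) t = perm_trm \<pi> (perm_trm \<rho> t)"
    and "perm_elem (\<pi> * \<rho>) e = perm_elem \<pi> (perm_elem \<rho> e)"
  by (induction t and e) (auto simp: apply_times mult.assoc)

lemma perm_hedge_times: "perm_hedge (\<pi> * \<rho>) s = perm_hedge \<pi> (perm_hedge \<rho> s)"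
  by (simp add: perm_hedge_def perm_times)

lemma perm_one [simp]:
  fixes t :: "('a, 'f, 'v, 'w) trm" and e :: "('a, 'f, 'v, 'w) elem"
  shows "perm_trm 1 t = t" and "perm_elem 1 e = e"
  by (induction t and e) (auto simp: map_idI)

lemma perm_hedge_one [simp]: "perm_hedge 1 s = s"
  by (simp add: perm_hedge_def map_idI)

lemma subst_hedge_susp [simp]: "subst_hedge \<sigma> (susp \<pi> \<chi>) = perm_hedge \<pi> (subst_var \<sigma> \<chi>)"
  by (cases \<chi>) auto

text \<open>A permutation accumulates on the left of a suspension, while a substitution replaces the
  variable on its right, so the two commute. Substitution does not avoid capture, hence abstractions
  impose no freshness condition. The suspension cases of \<open>subst_comp_apply\<close> rest on
  this.\<close>

lemma subst_perm:
  fixes t :: "('a, 'f, 'v, 'w) trm" and e :: "('a, 'f, 'v, 'w) elem"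
  shows "subst_trm \<sigma> (perm_trm \<pi> t) = perm_trm \<pi> (subst_trm \<sigma> t)"
    and "subst_elem \<sigma> (perm_elem \<pi> e) = perm_hedge \<pi> (subst_elem \<sigma> e)"
proof (induction t and e)
  case (Abs a s)
  then have "subst_hedge \<sigma> (perm_hedge \<pi> s) = perm_hedge \<pi> (subst_hedge \<sigma> s)"
    by (induction s) auto
  then show ?case
    by (simp add: o_def flip: subst_hedge_def perm_hedge_def)
next
  case (App f s)
  then have "subst_hedge \<sigma> (perm_hedge \<pi> s) = perm_hedge \<pi> (subst_hedge \<sigma> s)"
    by (induction s) auto
  then show ?case
    by (simp add: o_def flip: subst_hedge_def perm_hedge_def)
qed (simp_all add: perm_times perm_hedge_times)

lemma subst_hedge_perm: "subst_hedge \<sigma> (perm_hedge \<pi> s) = perm_hedge \<pi> (subst_hedge \<sigma> s)"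
  by (induction s) (auto simp: subst_perm)

lemma subst_comp_apply:
  fixes t :: "('a, 'f, 'v, 'w) trm" and e :: "('a, 'f, 'v, 'w) elem"
  shows "subst_trm (subst_comp \<sigma> \<tau>) t = subst_trm \<tau> (subst_trm \<sigma> t)"
    and "subst_elem (subst_comp \<sigma> \<tau>) e = subst_hedge \<tau> (subst_elem \<sigma> e)"
proof (induction t and e)
  case (Abs a s)
  then have "subst_hedge (subst_comp \<sigma> \<tau>) s = subst_hedge \<tau> (subst_hedge \<sigma> s)"
    by (induction s) auto
  then show ?case
    by (simp add: o_def flip: subst_hedge_def perm_hedge_def)
next
  case (App f s)
  then have "subst_hedge (subst_comp \<sigma> \<tau>) s = subst_hedge \<tau> (subst_hedge \<sigma> s)"
    by (induction s) auto
  then show ?case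
    by (simp add: o_def flip: subst_hedge_def perm_hedge_def)
qed (simp_all add: subst_comp_def subst_perm subst_hedge_perm)

lemma subst_hedge_comp: "subst_hedge (subst_comp \<sigma> \<tau>) s = subst_hedge \<tau> (subst_hedge \<sigma> s)"
  by (induction s) (auto simp: subst_comp_apply)

lemma subst_var_comp [simp]: "subst_var (subst_comp \<sigma> \<tau>) \<chi> = subst_hedge \<tau> (subst_var \<sigma> \<chi>)"
  by (cases \<chi>) (auto simp: subst_comp_def)

section \<open>Freshness and equivalence\<close>

inductive_simps fresh_simps [simp]:
  "fresh_trm \<Delta> a (Atom b)"
  "fresh_trm \<Delta> a (ISusp \<pi> x)"
  "fresh_elem \<Delta> a (HSusp \<pi> X)"
  "fresh_elem \<Delta> a (Term t)"

lemma fresh_App_iff [simp]: "fresh_trm \<Delta> a (App f s) \<longleftrightarrow> fresh_hedge \<Delta> a s"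
  by (subst fresh_trm.simps) (auto simp: fresh_hedge_def)

lemma fresh_Abs_iff [simp]: "fresh_trm \<Delta> a (Abs b s) \<longleftrightarrow> a = b \<or> fresh_hedge \<Delta> a s"
  by (subst fresh_trm.simps) (auto simp: fresh_hedge_def)

lemma fresh_hedge_simps [simp]:
  "fresh_hedge \<Delta> a []"
  "fresh_hedge \<Delta> a (e # s) \<longleftrightarrow> fresh_elem \<Delta> a e \<and> fresh_hedge \<Delta> a s"
  by (auto simp: fresh_hedge_def)

text \<open>Permutations act on suspensions by composition and never rename variables. So the
  context stays fixed and the whole effect is passed to the atom.\<close>

lemma fresh_perm [simp]:
  fixes t :: "('a, 'f, 'v, 'w) trm" and e :: "('a, 'f, 'v, 'w) elem"
  shows "fresh_trm \<Delta> a (perm_trm \<pi> t) \<longleftrightarrow> fresh_trm \<Delta> (Perm.apply (inverse \<pi>) a) t"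
    and "fresh_elem \<Delta> a (perm_elem \<pi> e) \<longleftrightarrow> fresh_elem \<Delta> (Perm.apply (inverse \<pi>) a) e"
  by (induction t and e) (auto simp: apply_times fresh_hedge_def)

lemma fresh_hedge_perm [simp]:
  "fresh_hedge \<Delta> a (perm_hedge \<pi> s) \<longleftrightarrow> fresh_hedge \<Delta> (Perm.apply (inverse \<pi>) a) s"
  by (induction s) auto

inductive_simps equiv_simps:
  "equiv_trm \<Delta> (Atom a) t"
  "equiv_trm \<Delta> (ISusp \<pi> x) t"
  "equiv_elem \<Delta> (HSusp \<pi> X) e"
  "equiv_elem \<Delta> (Term t) e"

lemma equiv_App_iff:
  "equiv_trm \<Delta> (App f s) t \<longleftrightarrow> (\<exists>q. t = App f q \<and> equiv_hedge \<Delta> s q)"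
  by (subst equiv_trm.simps) (auto simp: equiv_hedge_def)

text \<open>As \<open>(a a)\<close> is the identity, the two rules for abstractions can be merged.\<close>

lemma equiv_Abs_iff:
  "equiv_trm \<Delta> (Abs a s) t \<longleftrightarrow>
    (\<exists>b q. t = Abs b q \<and> equiv_hedge \<Delta> s (perm_hedge (Perm.swap a b) q) \<and>
      (a = b \<or> fresh_hedge \<Delta> a q))"
  by (subst equiv_trm.simps) (auto simp: equiv_hedge_def)

lemmas equiv_iffs = equiv_simps equiv_App_iff equiv_Abs_iff

lemma equiv_hedge_simps:
  "equiv_hedge \<Delta> [] q \<longleftrightarrow> q = []"
  "equiv_hedge \<Delta> (e # s) q \<longleftrightarrow> (\<exists>e' q'. q = e' # q' \<and> equiv_elem \<Delta> e e' \<and> equiv_hedge \<Delta> s q')"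
  by (auto simp: equiv_hedge_def list_all2_Cons1)

lemma equiv_hedge_append:
  "equiv_hedge \<Delta> s q \<Longrightarrow> equiv_hedge \<Delta> s' q' \<Longrightarrow> equiv_hedge \<Delta> (s @ s') (q @ q')"
  by (simp add: equiv_hedge_def list_all2_appendI)

text \<open>The second premise has the shape of the induction hypothesis at a node with children
  \<open>s\<close>; this closes the hedge cases inside the mutual induction of
  \<open>equiv_fresh\<close>. \<open>perm_hedge_transfer\<close> and
  \<open>equiv_hedge_trans_transfer\<close> serve the same purpose.\<close>

lemma fresh_hedge_transfer:
  assumes "equiv_hedge \<Delta> s q"
    and "\<And>e e'. e \<in> set s \<Longrightarrow> equiv_elem \<Delta> e e' \<Longrightarrow> fresh_elem \<Delta> a e \<longleftrightarrow> fresh_elem \<Delta> a e'"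
  shows "fresh_hedge \<Delta> a s \<longleftrightarrow> fresh_hedge \<Delta> a q"
  using assms by (induction s arbitrary: q) (auto simp: equiv_hedge_simps)

lemma equiv_fresh:
  fixes t :: "('a, 'f, 'v, 'w) trm" and e :: "('a, 'f, 'v, 'w) elem"
  shows "equiv_trm \<Delta> t t' \<Longrightarrow> fresh_trm \<Delta> a t \<longleftrightarrow> fresh_trm \<Delta> a t'"
    and "equiv_elem \<Delta> e e' \<Longrightarrow> fresh_elem \<Delta> a e \<longleftrightarrow> fresh_elem \<Delta> a e'"
proof (induction t and e arbitrary: t' a and e' a)
  case (ISusp \<pi> x)
  then show ?case by (auto simp: equiv_iffs) (metis apply_inverse_apply)+
next
  case (HSusp \<pi> X)
  then show ?case by (auto simp: equiv_iffs) (metis apply_inverse_apply)+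
next
  case (App f s)
  then obtain q where "t' = App f q" and eq: "equiv_hedge \<Delta> s q"
    by (auto simp: equiv_iffs)
  then show ?case
    using fresh_hedge_transfer[OF eq App.IH] by simp
next
  case (Abs b s)
  then obtain c q where t': "t' = Abs c q"
    and eq: "equiv_hedge \<Delta> s (perm_hedge (Perm.swap b c) q)" and fr: "b = c \<or> fresh_hedge \<Delta> b q"
    by (auto simp: equiv_iffs)
  \<comment> \<open>Atoms other than b and c are not moved. At d = c the question becomes freshness
    of b in \<open>q\<close>, which \<open>fr\<close> supplies when b and c differ; when the atom is
    the binder b itself, the right side needs that same fact.\<close>
  have "fresh_hedge \<Delta> d s \<longleftrightarrow> fresh_hedge \<Delta> (Perm.apply (Perm.swap b c) d) q" for d
    using fresh_hedge_transfer[OF eq Abs.IH] by simp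
  then show ?case
    using fr by (auto simp: t' apply_swap split: if_splits)
qed (auto simp: equiv_iffs)

lemma equiv_hedge_fresh: "equiv_hedge \<Delta> s q \<Longrightarrow> fresh_hedge \<Delta> a s \<longleftrightarrow> fresh_hedge \<Delta> a q"
  by (erule fresh_hedge_transfer) (rule equiv_fresh)

lemma perm_hedge_transfer:
  assumes "equiv_hedge \<Delta> s q"
    and "\<And>e e'. e \<in> set s \<Longrightarrow> equiv_elem \<Delta> e e' \<Longrightarrow> equiv_elem \<Delta> (perm_elem \<pi> e) (perm_elem \<pi> e')"
  shows "equiv_hedge \<Delta> (perm_hedge \<pi> s) (perm_hedge \<pi> q)"
  using assms by (induction s arbitrary: q) (auto simp: equiv_hedge_simps)

lemma equiv_perm:
  fixes t :: "('a, 'f, 'v, 'w) trm" and e :: "('a, 'f, 'v, 'w) elem"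
  shows "equiv_trm \<Delta> t t' \<Longrightarrow> equiv_trm \<Delta> (perm_trm \<pi> t) (perm_trm \<pi> t')"
    and "equiv_elem \<Delta> e e' \<Longrightarrow> equiv_elem \<Delta> (perm_elem \<pi> e) (perm_elem \<pi> e')"
proof (induction t and e arbitrary: t' and e')
  case (App f s)
  then obtain q where "t' = App f q" and eq: "equiv_hedge \<Delta> s q"
    by (auto simp: equiv_iffs)
  then show ?case
    using perm_hedge_transfer[OF eq App.IH] by (simp add: equiv_iffs flip: perm_hedge_def)
next
  case (Abs b s)
  then obtain c q where t': "t' = Abs c q"
    and eq: "equiv_hedge \<Delta> s (perm_hedge (Perm.swap b c) q)" and fr: "b = c \<or> fresh_hedge \<Delta> b q"
    by (auto simp: equiv_iffs)
  have "equiv_hedge \<Delta> (perm_hedge \<pi> s) (perm_hedge \<pi> (perm_hedge (Perm.swap b c) q))"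
    using perm_hedge_transfer[OF eq Abs.IH] .
  then show ?case
    using fr by (auto simp: t' equiv_iffs swap_conj[of \<pi>] simp flip: perm_hedge_def perm_hedge_times)
qed (auto simp: equiv_iffs apply_times apply_inj)

lemma equiv_hedge_perm:
  "equiv_hedge \<Delta> s q \<Longrightarrow> equiv_hedge \<Delta> (perm_hedge \<pi> s) (perm_hedge \<pi> q)"
  by (erule perm_hedge_transfer) (rule equiv_perm)

text \<open>Extends the disagreement condition on suspensions to all terms. It yields reflexivity
  and lets transitivity exchange a product of swappings for a single one. Both permutations vary in
  the induction because \<rho> is corrected at every binder.\<close>

lemma equiv_disagreement:
  fixes t :: "('a, 'f, 'v, 'w) trm" and e :: "('a, 'f, 'v, 'w) elem"
  shows "(\<And>a. Perm.apply \<pi> a \<noteq> Perm.apply \<rho> a \<Longrightarrow> fresh_trm \<Delta> a t) \<Longrightarrow>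
      equiv_trm \<Delta> (perm_trm \<pi> t) (perm_trm \<rho> t)"
    and "(\<And>a. Perm.apply \<pi> a \<noteq> Perm.apply \<rho> a \<Longrightarrow> fresh_elem \<Delta> a e) \<Longrightarrow>
      equiv_elem \<Delta> (perm_elem \<pi> e) (perm_elem \<rho> e)"
proof (induction t and e arbitrary: \<pi> \<rho> and \<pi> \<rho>)
  case (App f s)
  then have "\<forall>e\<in>set s. equiv_elem \<Delta> (perm_elem \<pi> e) (perm_elem \<rho> e)"
    by (auto simp: fresh_hedge_def)
  then show ?case
    by (simp add: equiv_iffs equiv_hedge_def list_all2_map1 list_all2_map2 list_all2_same)
next
  case (Abs b s)
  let ?b = "Perm.apply \<pi> b" and ?c = "Perm.apply \<rho> b"
  \<comment> \<open>The corrected permutation agrees with \<pi> at the binder b. Wherever else it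
    disagrees with \<pi>, so does \<rho>; hence only atoms known to be fresh for the body are
    affected.\<close>
  let ?\<rho> = "Perm.swap ?b ?c * \<rho>"
  have fr: "fresh_hedge \<Delta> a s" if "Perm.apply \<pi> a \<noteq> Perm.apply \<rho> a" "a \<noteq> b" for a
    using Abs.prems[OF that(1)] that(2) by simp
  have "fresh_hedge \<Delta> a s" if "Perm.apply \<pi> a \<noteq> Perm.apply ?\<rho> a" for a
    using that by (intro fr) (auto simp: apply_times apply_swap apply_inj split: if_splits)
  then have "\<forall>e\<in>set s. equiv_elem \<Delta> (perm_elem \<pi> e) (perm_elem ?\<rho> e)"
    using Abs.IH by (auto simp: fresh_hedge_def)
  then have "equiv_hedge \<Delta> (perm_hedge \<pi> s) (perm_hedge ?\<rho> s)"
    by (simp add: perm_hedge_def equiv_hedge_def list_all2_map1 list_all2_map2 list_all2_same)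
  \<comment> \<open>If the images of b differ, the atom that \<rho> sends to \<open>?b\<close> is
    not b, so \<pi> sends it elsewhere. The permutations thus disagree at that atom and
    \<open>fr\<close> applies.\<close>
  moreover have "?b = ?c \<or> fresh_hedge \<Delta> ?b (perm_hedge \<rho> s)"
    using fr[of "Perm.apply (inverse \<rho>) ?b"] by (auto simp: apply_eq_iff_inverse)
  ultimately show ?case
    by (simp add: equiv_iffs perm_hedge_times flip: perm_hedge_def)
next
  case (ISusp \<pi>' x)
  then show ?case by (auto simp: equiv_iffs apply_times) (metis apply_inverse_apply(1))
next
  case (HSusp \<pi>' x)
  then show ?case by (auto simp: equiv_iffs apply_times) (metis apply_inverse_apply(1))
next
  case (Atom b)
  from Atom[of b] have "Perm.apply \<pi> b = Perm.apply \<rho> b"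
    by (cases "Perm.apply \<pi> b = Perm.apply \<rho> b") auto
  then show ?case by (simp add: equiv_iffs)
qed (auto simp: equiv_iffs)

lemma equiv_hedge_disagreement:
  assumes "\<And>a. Perm.apply \<pi> a \<noteq> Perm.apply \<rho> a \<Longrightarrow> fresh_hedge \<Delta> a s"
  shows "equiv_hedge \<Delta> (perm_hedge \<pi> s) (perm_hedge \<rho> s)"
  using assms by (induction s) (auto simp: equiv_hedge_simps intro: equiv_disagreement)

lemma equiv_hedge_refl: "equiv_hedge \<Delta> s s"
  using equiv_hedge_disagreement[of 1 1 \<Delta> s] by simp

lemma equiv_hedge_trans_transfer:
  assumes "equiv_hedge \<Delta> s q" "equiv_hedge \<Delta> q u"
    and "\<And>e e' e''. e \<in> set s \<Longrightarrow> equiv_elem \<Delta> e e' \<Longrightarrow> equiv_elem \<Delta> e' e'' \<Longrightarrow> equiv_elem \<Delta> e e''"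
  shows "equiv_hedge \<Delta> s u"
  using assms by (induction s arbitrary: q u) (auto simp: equiv_hedge_simps)

lemma equiv_trans:
  fixes t :: "('a, 'f, 'v, 'w) trm" and e :: "('a, 'f, 'v, 'w) elem"
  shows "equiv_trm \<Delta> t t' \<Longrightarrow> equiv_trm \<Delta> t' t'' \<Longrightarrow> equiv_trm \<Delta> t t''"
    and "equiv_elem \<Delta> e e' \<Longrightarrow> equiv_elem \<Delta> e' e'' \<Longrightarrow> equiv_elem \<Delta> e e''"
proof (induction t and e arbitrary: t' t'' and e' e'')
  case (App f s)
  then obtain q u where "t'' = App f u" and eq: "equiv_hedge \<Delta> s q" "equiv_hedge \<Delta> q u"
    by (auto simp: equiv_iffs)
  then show ?case
    using equiv_hedge_trans_transfer[OF eq App.IH] by (simp add: equiv_iffs)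
next
  case (Abs a s)
  then obtain b q c u where t': "t' = Abs b q" "t'' = Abs c u"
    and 1: "equiv_hedge \<Delta> s (perm_hedge (Perm.swap a b) q)" and ab: "a = b \<or> fresh_hedge \<Delta> a q"
    and 2: "equiv_hedge \<Delta> q (perm_hedge (Perm.swap b c) u)" and bc: "b = c \<or> fresh_hedge \<Delta> b u"
    by (auto simp: equiv_iffs)
  have "fresh_hedge \<Delta> a q \<longleftrightarrow> fresh_hedge \<Delta> (Perm.apply (Perm.swap b c) a) u"
    using equiv_hedge_fresh[OF 2] by simp
  then have ac: "a = c \<or> fresh_hedge \<Delta> a u"
    using ab bc by (auto simp: apply_swap split: if_splits)
  \<comment> \<open>The middle hedge is a permuted \<open>q\<close>, but the induction hypothesis
    constrains only the first member of a chain, here an element of \<open>s\<close>.\<close>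
  have "equiv_hedge \<Delta> s (perm_hedge (Perm.swap a b * Perm.swap b c) u)"
    using equiv_hedge_trans_transfer[OF 1 equiv_hedge_perm[OF 2] Abs.IH] by (simp add: perm_hedge_times)
  \<comment> \<open>The two permutations can differ only at a and b, and only if c is neither of
    them; then \<open>ac\<close> and \<open>bc\<close> make both atoms fresh for
    \<open>u\<close>.\<close>
  moreover have "equiv_hedge \<Delta> (perm_hedge (Perm.swap a b * Perm.swap b c) u) (perm_hedge (Perm.swap a c) u)"
    using ac bc by (intro equiv_hedge_disagreement) (auto simp: apply_times apply_swap split: if_splits)
  ultimately have "equiv_hedge \<Delta> s (perm_hedge (Perm.swap a c) u)"
    by (rule equiv_hedge_trans_transfer) (rule Abs.IH)
  then show ?case using ac by (simp add: t' equiv_iffs)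
qed (auto simp: equiv_iffs; metis)+

lemma equiv_hedge_trans: "equiv_hedge \<Delta> s q \<Longrightarrow> equiv_hedge \<Delta> q u \<Longrightarrow> equiv_hedge \<Delta> s u"
  by (rule equiv_hedge_trans_transfer) (auto intro: equiv_trans)

section \<open>Instances of freshness contexts\<close>

text \<open>A context enters a freshness derivation only through membership of constraints. Closure
  under intersection is what makes a least satisfying context exist.\<close>

lemma fresh_Int:
  fixes t :: "('a, 'f, 'v, 'w) trm" and e :: "('a, 'f, 'v, 'w) elem"
  shows "fresh_trm \<Delta> a t \<Longrightarrow> fresh_trm \<Delta>' a t \<Longrightarrow> fresh_trm (\<Delta> \<inter> \<Delta>') a t"
    and "fresh_elem \<Delta> a e \<Longrightarrow> fresh_elem \<Delta>' a e \<Longrightarrow> fresh_elem (\<Delta> \<inter> \<Delta>') a e"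
  by (induction t and e) (auto simp: fresh_hedge_def)

lemma satisfies_under_Int:
  "satisfies_under G \<Delta> \<sigma> \<Longrightarrow> satisfies_under G' \<Delta> \<sigma> \<Longrightarrow> satisfies_under (G \<inter> G') \<Delta> \<sigma>"
  by (auto simp: satisfies_under_def fresh_hedge_def intro!: fresh_Int)

text \<open>\<open>LEAST\<close> is informative only once a minimum is known to exist. A satisfying
  context \<open>M\<close> of minimal cardinality is one: its intersection with any other satisfying
  context still satisfies, so it cannot be smaller than \<open>M\<close> and equals it.\<close>

lemma subst_ctx_subset:
  assumes "finite G" "satisfies_under G \<Delta> \<sigma>"
  shows "subst_ctx \<Delta> \<sigma> \<subseteq> G"
proof -
  let ?P = "\<lambda>G. finite G \<and> satisfies_under G \<Delta> \<sigma>"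
  obtain M where M: "?P M" "\<And>G. ?P G \<Longrightarrow> card M \<le> card G"
    using assms ex_has_least_nat[of ?P G card] by blast
  have least: "M \<subseteq> G" if "?P G" for G
  proof -
    have "card M \<le> card (M \<inter> G)"
      using M(1) that by (intro M(2)) (auto intro: satisfies_under_Int)
    then have "M \<inter> G = M"
      using M(1) by (intro card_seteq) auto
    then show ?thesis by blast
  qed
  have "subst_ctx \<Delta> \<sigma> = M"
    unfolding subst_ctx_def using M(1) least by (intro Least_equality) auto
  then show ?thesis
    using least assms by simp
qed

text \<open>Freshness for a suspension is a single membership, so satisfaction under G amounts to
  inclusion of an explicit image in G. The assumption on \<open>subst_var \<tau>\<close> covers
  \<open>isingle\<close> and \<open>hsingle\<close> alike, and with them all merging and narrowing
  steps.\<close>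

lemma subst_ctx_susp:
  fixes \<tau> :: "('a, 'f, 'v, 'w) subst"
  assumes "subst_var \<tau> = (susp 1)(\<chi> := susp \<pi> \<chi>')" "finite \<Gamma>"
  shows "subst_ctx \<Gamma> \<tau> =
    (\<lambda>(a, \<xi>). if \<xi> = \<chi> then (Perm.apply (inverse \<pi>) a, \<chi>') else (a, \<xi>)) ` \<Gamma>" (is "_ = ?E")
proof -
  have fresh_susp: "fresh_hedge G a (susp \<rho> \<xi> :: ('a, 'f, 'v, 'w) hedge) \<longleftrightarrow>
      (Perm.apply (inverse \<rho>) a, \<xi>) \<in> G" for G a \<rho> \<xi>
    by (cases \<xi>) auto
  have "satisfies_under G \<Gamma> \<tau> \<longleftrightarrow> ?E \<subseteq> G" for G
    unfolding satisfies_under_def assms(1) image_subset_iff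
    by (intro ball_cong) (auto simp: fresh_susp)
  then show ?thesis
    unfolding subst_ctx_def using assms(2) by (intro Least_equality) auto
qed

text \<open>For each constraint on \<chi>, both sides ask whether the atom moved by the inverse of
  \<pi> is fresh for the value of \<theta> at \<chi>'. This transports constraints through merging
  and narrowing.\<close>

lemma satisfies_under_subst_ctx_susp:
  assumes "subst_var \<tau> = (susp 1)(\<chi> := susp \<pi> \<chi>')" "finite \<Gamma>"
  shows "satisfies_under \<Delta> (subst_ctx \<Gamma> \<tau>) \<theta> \<longleftrightarrow> satisfies_under \<Delta> \<Gamma> (subst_comp \<tau> \<theta>)"
  unfolding subst_ctx_susp[OF assms] satisfies_under_def ball_simps
  by (intro ball_cong) (auto simp: assms(1) split: if_splits)

section \<open>Based and proper hedges\<close>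

lemma based_hedge_simps [simp]:
  "based_hedge A []"
  "based_hedge A (e # s) \<longleftrightarrow> atoms_elem e \<subseteq> A \<and> based_hedge A s"
  "based_hedge A (s @ q) \<longleftrightarrow> based_hedge A s \<and> based_hedge A q"
  by (auto simp: based_hedge_def atoms_hedge_def)

lemma atoms_Abs_subset [simp]: "atoms_trm (Abs a s) \<subseteq> A \<longleftrightarrow> a \<in> A \<and> based_hedge A s"
  by (auto simp: based_hedge_def atoms_hedge_def)

lemma atoms_App_subset [simp]: "atoms_trm (App f s) \<subseteq> A \<longleftrightarrow> based_hedge A s"
  by (auto simp: based_hedge_def atoms_hedge_def)

lemma based_hedge_iff: "based_hedge A s \<longleftrightarrow> (\<forall>e\<in>set s. atoms_elem e \<subseteq> A)"
  by (auto simp: based_hedge_def atoms_hedge_def)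

lemma based_susp [simp]: "based_hedge A (susp \<pi> \<chi>) \<longleftrightarrow> affected \<pi> \<subseteq> A"
  by (cases \<chi>) auto

lemma atoms_perm_subset:
  fixes t :: "('a, 'f, 'v, 'w) trm" and e :: "('a, 'f, 'v, 'w) elem"
  assumes "affected \<pi> \<subseteq> A"
  shows "atoms_trm t \<subseteq> A \<Longrightarrow> atoms_trm (perm_trm \<pi> t) \<subseteq> A"
    and "atoms_elem e \<subseteq> A \<Longrightarrow> atoms_elem (perm_elem \<pi> e) \<subseteq> A"
proof (induction t and e)
  case (Abs a s)
  then show ?case
    using assms by (simp del: atoms_trm.simps add: apply_closed) (simp add: based_hedge_iff)
next
  case (App f s)
  then show ?case
    by (simp del: atoms_trm.simps) (simp add: based_hedge_iff)
qed (use assms in \<open>auto simp del: affected_times simp add: affected_times_subset apply_closed\<close>)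

lemma based_perm_hedge:
  "affected \<pi> \<subseteq> A \<Longrightarrow> based_hedge A s \<Longrightarrow> based_hedge A (perm_hedge \<pi> s)"
  by (simp add: based_hedge_iff perm_hedge_def atoms_perm_subset)

lemma atoms_subst_subset:
  fixes t :: "('a, 'f, 'v, 'w) trm" and e :: "('a, 'f, 'v, 'w) elem"
  assumes "\<And>\<chi>. based_hedge A (subst_var \<tau> \<chi>)"
  shows "atoms_trm t \<subseteq> A \<Longrightarrow> atoms_trm (subst_trm \<tau> t) \<subseteq> A"
    and "atoms_elem e \<subseteq> A \<Longrightarrow> based_hedge A (subst_elem \<tau> e)"
proof (induction t and e)
  case (ISusp \<pi> x)
  then show ?case using assms[of "IVar x"] by (simp add: atoms_perm_subset)
next
  case (HSusp \<pi> X)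
  then show ?case using assms[of "HVar X"] by (simp add: based_perm_hedge)
next
  case (Abs a s)
  then show ?case
    by (simp del: atoms_trm.simps) (simp add: based_hedge_iff)
next
  case (App f s)
  then show ?case
    by (simp del: atoms_trm.simps) (simp add: based_hedge_iff)
qed simp_all

lemma based_subst_hedge:
  assumes "\<And>\<chi>. based_hedge A (subst_var \<tau> \<chi>)" "based_hedge A s"
  shows "based_hedge A (subst_hedge \<tau> s)"
  using assms(2) by (induction s) (auto simp: atoms_subst_subset(2)[OF assms(1)])

lemma proper_hedge_simps [simp]:
  "proper_hedge []"
  "proper_hedge (e # s) \<longleftrightarrow> proper_elem e \<and> proper_hedge s"
  "proper_hedge (s @ q) \<longleftrightarrow> proper_hedge s \<and> proper_hedge q"
  by (auto simp: proper_hedge_def)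

inductive_simps proper_simps:
  "proper_elem (Term t)"
  "proper_elem (HSusp \<pi> X)"
  "proper_trm (Atom a)"
  "proper_trm (ISusp \<pi> x)"
  "proper_trm (App f s)"
  "proper_trm (Abs a s)"

lemma proper_perm:
  fixes t :: "('a, 'f, 'v, 'w) trm" and e :: "('a, 'f, 'v, 'w) elem"
  shows "proper_trm t \<Longrightarrow> proper_trm (perm_trm \<pi> t)"
    and "proper_elem e \<Longrightarrow> proper_elem (perm_elem \<pi> e)"
  by (induction t and e) (auto simp: proper_simps)

lemma proper_susp [simp]: "proper_hedge (susp \<pi> \<chi>)"
  by (cases \<chi>) (auto simp: proper_simps)

section \<open>The invariant of the algorithm\<close>

text \<open>The argument \<open>sd\<close> is \<open>fst\<close> or \<open>snd\<close> and selects the side of the problems.\<close>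

definition side_matches ::
  "('a, 'v, 'w) fctx \<Rightarrow> (('a, 'f, 'v, 'w) hedge \<times> ('a, 'f, 'v, 'w) hedge \<Rightarrow> ('a, 'f, 'v, 'w) hedge) \<Rightarrow>
   ('a, 'f, 'v, 'w) aup set \<Rightarrow> ('a, 'f, 'v, 'w) subst \<Rightarrow> bool" where
  "side_matches \<Delta> sd Q \<theta> \<longleftrightarrow> (\<forall>(\<chi>, p)\<in>Q. equiv_hedge \<Delta> (subst_var \<theta> \<chi>) (sd p))"

text \<open>\<theta> ranges over all assignments, not only those with \<open>is_subst\<close>.
  Compositions with the possibly improper bindings of the algorithm therefore stay in range.\<close>

definition side_sound ::
  "('a, 'v, 'w) fctx \<Rightarrow> (('a, 'f, 'v, 'w) hedge \<times> ('a, 'f, 'v, 'w) hedge \<Rightarrow> ('a, 'f, 'v, 'w) hedge) \<Rightarrow>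
   ('a, 'f, 'v, 'w) aup set \<Rightarrow> ('a, 'v, 'w) fctx \<Rightarrow>
   ('a, 'f, 'v, 'w) hedge \<Rightarrow> ('a, 'f, 'v, 'w) hedge \<Rightarrow> bool" where
  "side_sound \<Delta> sd Q \<Gamma> s u \<longleftrightarrow>
    (\<forall>\<theta>. side_matches \<Delta> sd Q \<theta> \<longrightarrow>
      equiv_hedge \<Delta> (subst_hedge \<theta> s) u \<and> satisfies_under \<Delta> \<Gamma> \<theta>)"

text \<open>Properness of the sides makes the final match a genuine substitution. The last conjunct
  allows a problem labelled by an individual variable to be matched, since such a variable can only
  take an individual term.\<close>

fun aup_ok :: "'a set \<Rightarrow> ('a, 'f, 'v, 'w) aup \<Rightarrow> bool" where
  "aup_ok A (\<chi>, l, r) \<longleftrightarrow>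
    (\<forall>s\<in>{l, r}. proper_hedge s \<and> based_hedge A s \<and> (\<forall>x. \<chi> = IVar x \<longrightarrow> (\<exists>t. s = [Term t])))"

text \<open>Distinct labels ensure that binding one label leaves the other problems alone.
  Constraints mention only labels of \<open>S\<close>, so binding a label of \<open>P\<close> does
  not touch \<open>\<Gamma>\<close>.\<close>

fun state_ok ::
  "'a set \<Rightarrow> ('a, 'v, 'w) fctx \<Rightarrow> ('v, 'w) var \<Rightarrow> ('a, 'f, 'v, 'w) hedge \<Rightarrow> ('a, 'f, 'v, 'w) hedge \<Rightarrow>
   ('a, 'f, 'v, 'w) state \<Rightarrow> bool" where
  "state_ok A \<Delta> \<xi> l r (P, S, \<Gamma>, \<sigma>) \<longleftrightarrow>
    finite P \<and> finite S \<and> inj_on fst (P \<union> S) \<and> P \<inter> S = {} \<and> (\<forall>p\<in>P \<union> S. aup_ok A p) \<and>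
    finite \<Gamma> \<and> vars_ctx \<Gamma> \<subseteq> fst ` S \<and> based_ctx A \<Gamma> \<and> based_hedge A (subst_var \<sigma> \<xi>) \<and>
    side_sound \<Delta> fst (P \<union> S) \<Gamma> (subst_var \<sigma> \<xi>) l \<and> side_sound \<Delta> snd (P \<union> S) \<Gamma> (subst_var \<sigma> \<xi>) r"

section \<open>Transformations of states that preserve the invariant\<close>

lemma side_sound_subst:
  assumes "side_sound \<Delta> sd Q \<Gamma> s u"
    and "\<And>\<theta>. side_matches \<Delta> sd Q' \<theta> \<Longrightarrow> side_matches \<Delta> sd Q (subst_comp \<tau> \<theta>)"
    and "\<And>\<theta>. side_matches \<Delta> sd Q' \<theta> \<Longrightarrow> satisfies_under \<Delta> \<Gamma> (subst_comp \<tau> \<theta>) \<Longrightarrow>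
      satisfies_under \<Delta> \<Gamma>' \<theta>"
  shows "side_sound \<Delta> sd Q' \<Gamma>' (subst_hedge \<tau> s) u"
  using assms unfolding side_sound_def subst_hedge_comp[symmetric] by blast

lemma side_matches_simps:
  "side_matches \<Delta> sd {} \<theta>"
  "side_matches \<Delta> sd (insert (\<chi>, p) Q) \<theta> \<longleftrightarrow>
    equiv_hedge \<Delta> (subst_var \<theta> \<chi>) (sd p) \<and> side_matches \<Delta> sd Q \<theta>"
  "side_matches \<Delta> sd (Q \<union> R) \<theta> \<longleftrightarrow> side_matches \<Delta> sd Q \<theta> \<and> side_matches \<Delta> sd R \<theta>"
  by (auto simp: side_matches_def)

lemma side_matches_comp_single:
  assumes "subst_var \<tau> = (susp 1)(\<chi> := u)" "\<chi> \<notin> fst ` Q"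
  shows "side_matches \<Delta> sd Q (subst_comp \<tau> \<theta>) \<longleftrightarrow> side_matches \<Delta> sd Q \<theta>"
  using assms(2) unfolding side_matches_def by (intro ball_cong) (force simp: assms(1))+

lemma satisfies_under_comp_single:
  assumes "subst_var \<tau> = (susp 1)(\<chi> := u)" "\<chi> \<notin> vars_ctx \<Gamma>"
  shows "satisfies_under \<Delta> \<Gamma> (subst_comp \<tau> \<theta>) \<longleftrightarrow> satisfies_under \<Delta> \<Gamma> \<theta>"
  using assms(2) unfolding satisfies_under_def
  by (intro ball_cong) (force simp: assms(1) vars_ctx_def)+

lemma based_subst_hedge_single:
  assumes "subst_var \<tau> = (susp 1)(\<chi> := u)" "based_hedge A u" "based_hedge A s"
  shows "based_hedge A (subst_hedge \<tau> s)"
  using assms(2,3) by (intro based_subst_hedge) (auto simp: assms(1))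

text \<open>Common form of the trivial, decomposition and abstraction rules: one problem is replaced
  by the set \<open>N\<close> of its subproblems, which is empty for the trivial rules. By
  \<open>sides\<close>, a match of \<open>N\<close> turns the binding \<open>u\<close> into a hedge
  equivalent to the original side.\<close>

lemma state_ok_eliminate:
  assumes ok: "state_ok A \<Delta> \<xi> l r (insert (\<chi>, l', r') P, S, \<Gamma>, \<sigma>)" and "(\<chi>, l', r') \<notin> P"
    and \<tau>: "subst_var \<tau> = (susp 1)(\<chi> := u)" and u: "based_hedge A u"
    and N: "finite N" "inj_on fst N" "fst ` N \<inter> fst ` (insert (\<chi>, l', r') P \<union> S) = {}"
      "\<forall>p\<in>N. aup_ok A p"
    and sides: "\<And>\<theta>. side_matches \<Delta> fst N \<theta> \<Longrightarrow> equiv_hedge \<Delta> (subst_hedge \<theta> u) l'"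
      "\<And>\<theta>. side_matches \<Delta> snd N \<theta> \<Longrightarrow> equiv_hedge \<Delta> (subst_hedge \<theta> u) r'"
  shows "state_ok A \<Delta> \<xi> l r (N \<union> P, S, \<Gamma>, subst_comp \<sigma> \<tau>)"
proof -
  have inj: "inj_on fst (insert (\<chi>, l', r') P \<union> S)" and dis: "insert (\<chi>, l', r') P \<inter> S = {}"
    using ok by auto
  \<comment> \<open>By injectivity another problem labelled \<chi> would be the removed one, which
    lies neither in \<open>P\<close> nor in \<open>S\<close>.\<close>
  have \<chi>: "\<chi> \<notin> fst ` (P \<union> S)"
    using inj dis assms(2) by (force simp: inj_on_def)
  then have \<Gamma>: "\<chi> \<notin> vars_ctx \<Gamma>"
    using ok by auto
  have sound: "side_sound \<Delta> sd (N \<union> P \<union> S) \<Gamma> (subst_hedge \<tau> s) w"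
    if "side_sound \<Delta> sd (insert (\<chi>, l', r') P \<union> S) \<Gamma> s w"
      "\<And>\<theta>. side_matches \<Delta> sd N \<theta> \<Longrightarrow> equiv_hedge \<Delta> (subst_hedge \<theta> u) (sd (l', r'))"
    for sd s w
  proof (rule side_sound_subst[OF that(1)])
    fix \<theta> assume m: "side_matches \<Delta> sd (N \<union> P \<union> S) \<theta>"
    then show "side_matches \<Delta> sd (insert (\<chi>, l', r') P \<union> S) (subst_comp \<tau> \<theta>)"
      using side_matches_comp_single[OF \<tau> \<chi>, of \<Delta> sd \<theta>] that(2)
      by (simp add: side_matches_simps \<tau>)
  qed (simp add: satisfies_under_comp_single[OF \<tau> \<Gamma>])
  have "inj_on fst (N \<union> (P \<union> S))"
    using inj N(2,3) by (subst inj_on_Un) (auto simp: inj_on_Un)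
  then show ?thesis
    using ok N sides sound[of fst] sound[of snd] based_subst_hedge_single[OF \<tau> u]
    by (auto simp: Un_assoc)
qed

text \<open>The union of \<open>P\<close> and \<open>S\<close> is unchanged, so the matches are the
  same. The added constraints hold because a match sends \<chi> to a hedge equivalent to a side, and
  equivalence preserves freshness.\<close>

lemma state_ok_solve:
  assumes ok: "state_ok A \<Delta> \<xi> l r (insert (\<chi>, l', r') P, S, \<Gamma>, \<sigma>)" and "(\<chi>, l', r') \<notin> P" "finite A"
  shows "state_ok A \<Delta> \<xi> l r
    (P, {(\<chi>, l', r')} \<union> S, common_fresh A \<Delta> \<chi> l' r' \<union> \<Gamma>, \<sigma>)"
proof -
  have eq: "insert (\<chi>, l', r') P \<union> S = P \<union> insert (\<chi>, l', r') S" by auto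
  have sound: "side_sound \<Delta> sd (P \<union> insert (\<chi>, l', r') S) (common_fresh A \<Delta> \<chi> l' r' \<union> \<Gamma>) s w"
    if "side_sound \<Delta> sd (P \<union> insert (\<chi>, l', r') S) \<Gamma> s w" "sd (l', r') \<in> {l', r'}" for sd s w
    using that equiv_hedge_fresh
    by (fastforce simp: side_sound_def side_matches_simps satisfies_under_def common_fresh_def)
  have "finite (common_fresh A \<Delta> \<chi> l' r')"
    using assms(3) by (auto simp: common_fresh_def)
  then show ?thesis
    using ok assms(2) sound[of fst] sound[of snd]
    by (auto simp: eq common_fresh_def vars_ctx_def based_ctx_def atoms_ctx_def)
qed

text \<open>Common form of merging and narrowing. The problem that replaces the old one may already
  belong to \<open>S\<close>, as in merging, or be new, as in narrowing.\<close>

lemma state_ok_rename: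
  assumes ok: "state_ok A \<Delta> \<xi> l r (P, insert (\<chi>\<^sub>2, l\<^sub>2, r\<^sub>2) S, \<Gamma>, \<sigma>)" and "(\<chi>\<^sub>2, l\<^sub>2, r\<^sub>2) \<notin> S"
    and \<tau>: "subst_var \<tau> = (susp 1)(\<chi>\<^sub>2 := susp \<pi> \<chi>\<^sub>1)" and \<pi>: "based_perm A \<pi>"
    and new: "inj_on fst (P \<union> insert (\<chi>\<^sub>1, l\<^sub>1, r\<^sub>1) S)" "(\<chi>\<^sub>1, l\<^sub>1, r\<^sub>1) \<notin> P" "aup_ok A (\<chi>\<^sub>1, l\<^sub>1, r\<^sub>1)"
    and sides: "equiv_hedge \<Delta> (perm_hedge \<pi> l\<^sub>1) l\<^sub>2" "equiv_hedge \<Delta> (perm_hedge \<pi> r\<^sub>1) r\<^sub>2"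
  shows "state_ok A \<Delta> \<xi> l r (P, {(\<chi>\<^sub>1, l\<^sub>1, r\<^sub>1)} \<union> S, subst_ctx \<Gamma> \<tau>, subst_comp \<sigma> \<tau>)"
proof -
  have inj: "inj_on fst (P \<union> insert (\<chi>\<^sub>2, l\<^sub>2, r\<^sub>2) S)" and dis: "P \<inter> insert (\<chi>\<^sub>2, l\<^sub>2, r\<^sub>2) S = {}"
    and fin: "finite \<Gamma>" and \<Gamma>: "vars_ctx \<Gamma> \<subseteq> fst ` insert (\<chi>\<^sub>2, l\<^sub>2, r\<^sub>2) S" "based_ctx A \<Gamma>"
    using ok by auto
  have \<chi>: "\<chi>\<^sub>2 \<notin> fst ` (P \<union> S)"
    using inj dis assms(2) by (force simp: inj_on_def)
  have sound: "side_sound \<Delta> sd (P \<union> insert (\<chi>\<^sub>1, l\<^sub>1, r\<^sub>1) S) (subst_ctx \<Gamma> \<tau>) (subst_hedge \<tau> s) w"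
    if "side_sound \<Delta> sd (P \<union> insert (\<chi>\<^sub>2, l\<^sub>2, r\<^sub>2) S) \<Gamma> s w"
      "equiv_hedge \<Delta> (perm_hedge \<pi> (sd (l\<^sub>1, r\<^sub>1))) (sd (l\<^sub>2, r\<^sub>2))" for sd s w
  proof (rule side_sound_subst[OF that(1)])
    fix \<theta> assume m: "side_matches \<Delta> sd (P \<union> insert (\<chi>\<^sub>1, l\<^sub>1, r\<^sub>1) S) \<theta>"
    \<comment> \<open>The match gives equivalence before \<pi> is applied; applying \<pi> and
      chaining with the merging condition reaches the side of the old problem.\<close>
    then have "equiv_hedge \<Delta> (perm_hedge \<pi> (subst_var \<theta> \<chi>\<^sub>1)) (sd (l\<^sub>2, r\<^sub>2))"
      using that(2) by (auto simp: side_matches_simps intro: equiv_hedge_trans equiv_hedge_perm)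
    then show "side_matches \<Delta> sd (P \<union> insert (\<chi>\<^sub>2, l\<^sub>2, r\<^sub>2) S) (subst_comp \<tau> \<theta>)"
      using m side_matches_comp_single[OF \<tau> \<chi>, of \<Delta> sd \<theta>] by (simp add: side_matches_simps \<tau>)
  qed (simp add: satisfies_under_subst_ctx_susp[OF \<tau> fin])
  have "vars_ctx (subst_ctx \<Gamma> \<tau>) \<subseteq> fst ` insert (\<chi>\<^sub>1, l\<^sub>1, r\<^sub>1) S"
    unfolding subst_ctx_susp[OF \<tau> fin] vars_ctx_def image_image image_subset_iff split_def
  proof
    fix p assume "p \<in> \<Gamma>"
    then have "snd p = \<chi>\<^sub>2 \<or> snd p \<in> fst ` S"
      using \<Gamma>(1) by (auto simp: vars_ctx_def)
    then show "snd (if snd p = \<chi>\<^sub>2 then (Perm.apply (inverse \<pi>) (fst p), \<chi>\<^sub>1) else (fst p, snd p))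
        \<in> fst ` insert (\<chi>\<^sub>1, l\<^sub>1, r\<^sub>1) S"
      by auto
  qed
  moreover have "based_ctx A (subst_ctx \<Gamma> \<tau>)"
    unfolding subst_ctx_susp[OF \<tau> fin] based_ctx_def atoms_ctx_def image_image image_subset_iff split_def
  proof
    fix p assume "p \<in> \<Gamma>"
    then have "fst p \<in> A"
      using \<Gamma>(2) by (auto simp: based_ctx_def atoms_ctx_def)
    then show "fst (if snd p = \<chi>\<^sub>2 then (Perm.apply (inverse \<pi>) (fst p), \<chi>\<^sub>1) else (fst p, snd p)) \<in> A"
      using \<pi> by (simp add: based_perm_def apply_closed)
  qed
  moreover have "finite (subst_ctx \<Gamma> \<tau>)"
    using fin by (simp add: subst_ctx_susp[OF \<tau> fin])
  moreover have "based_hedge A (subst_hedge \<tau> s)" if "based_hedge A s" for s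
    using \<pi> that by (intro based_subst_hedge_single[OF \<tau>]) (auto simp: based_perm_def)
  ultimately show ?thesis
    using ok new sides sound[of fst] sound[of snd] by (auto simp del: aup_ok.simps)
qed

section \<open>Preservation of the invariant by the individual rules\<close>

lemma subst_var_hsingle: "subst_var (hsingle X u) = (susp 1)(HVar X := u)"
proof
  show "subst_var (hsingle X u) \<chi> = ((susp 1)(HVar X := u)) \<chi>" for \<chi>
    by (cases \<chi>) (auto simp: hsingle_def subst_id_def)
qed

lemma subst_var_isingle:
  "subst_var (isingle x (ISusp \<pi> y)) = (susp 1)(IVar x := susp \<pi> (IVar y))"
proof
  show "subst_var (isingle x (ISusp \<pi> y)) \<chi> = ((susp 1)(IVar x := susp \<pi> (IVar y))) \<chi>" for \<chi>
    by (cases \<chi>) (auto simp: isingle_def subst_id_def)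
qed

lemma new_var_not_labelled: "new_var \<Delta> (P, S, \<Gamma>, \<sigma>) \<chi> \<Longrightarrow> \<chi> \<notin> fst ` (P \<union> S)"
  by (force simp: new_var_def vars_aups_def)

lemma state_ok_vnau:
  assumes "vnau A \<Delta> st st'" "finite A" "state_ok A \<Delta> \<xi> l r st"
  shows "state_ok A \<Delta> \<xi> l r st'"
  using assms(1)
proof cases
  case (Tri_T X a P S \<Gamma> \<sigma>)
  with assms(3) show ?thesis
    using state_ok_eliminate[of A \<Delta> \<xi> l r "HVar X" "[Term (Atom a)]" "[Term (Atom a)]" P S \<Gamma> \<sigma>,
        OF _ _ subst_var_hsingle, where N = "{}"]
    by (auto simp: equiv_hedge_refl)
next
  case (Tri_H X P S \<Gamma> \<sigma>)
  with assms(3) show ?thesis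
    using state_ok_eliminate[of A \<Delta> \<xi> l r "HVar X" "[]" "[]" P S \<Gamma> \<sigma>,
        OF _ _ subst_var_hsingle, where N = "{}"]
    by (auto simp: equiv_hedge_refl)
next
  case (Dec_T X f s q P S \<Gamma> \<sigma> Y)
  have ok: "aup_ok A (HVar X, [Term (App f s)], [Term (App f q)])"
    using assms(3) unfolding Dec_T(2) by simp
  then have "aup_ok A (HVar Y, s, q)"
    by (simp add: proper_simps proper_hedge_def del: atoms_trm.simps)
  then show ?thesis
    unfolding Dec_T(1)
    using assms(3) new_var_not_labelled[OF Dec_T(4)[unfolded Dec_T(2)]] Dec_T(3)
    by (intro state_ok_eliminate[OF _ _ subst_var_hsingle])
      (auto simp: Dec_T(2) side_matches_simps equiv_hedge_simps equiv_iffs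
        simp del: aup_ok.simps state_ok.simps)
next
  case (Dec_H X s\<^sub>1 s\<^sub>2 q\<^sub>1 q\<^sub>2 P S \<Gamma> \<sigma> Y\<^sub>1 Y\<^sub>2)
  have ok: "aup_ok A (HVar X, s\<^sub>1 @ s\<^sub>2, q\<^sub>1 @ q\<^sub>2)"
    using assms(3) unfolding Dec_H(2) by simp
  then have "aup_ok A (HVar Y\<^sub>1, s\<^sub>1, q\<^sub>1)" "aup_ok A (HVar Y\<^sub>2, s\<^sub>2, q\<^sub>2)"
    by simp_all
  then show ?thesis
    unfolding Dec_H(1)
    using assms(3) new_var_not_labelled[OF Dec_H(6)[unfolded Dec_H(2)]]
      new_var_not_labelled[OF Dec_H(7)[unfolded Dec_H(2)]] Dec_H(3,8)
    by (intro state_ok_eliminate[OF _ _ subst_var_hsingle])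
      (auto simp: Dec_H(2) side_matches_simps intro: equiv_hedge_append simp del: aup_ok.simps state_ok.simps)
next
  case (Abs_T X a t\<^sub>1 b t\<^sub>2 P S \<Gamma> \<sigma> c Y)
  have ok: "aup_ok A (HVar X, [Term (Abs a [Term t\<^sub>1])], [Term (Abs b [Term t\<^sub>2])])"
    using assms(3) unfolding Abs_T(2) by simp
  \<comment> \<open>The atom c is in \<open>A\<close> by the rule, and a and b are because the old
    problem is \<open>A\<close>-based; hence both swappings are \<open>A\<close>-based.\<close>
  then have "aup_ok A (HVar Y, [Term (perm_trm (Perm.swap c a) t\<^sub>1)], [Term (perm_trm (Perm.swap c b) t\<^sub>2)])"
    using Abs_T(4) by (auto simp: proper_simps proper_perm atoms_perm_subset affected_swap_subset
      simp del: atoms_trm.simps)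
  \<comment> \<open>If \<open>Y\<close> is matched with the swapped body, the abstraction over c is
    equivalent to the original one by \<open>equiv_Abs_iff\<close>; the freshness conditions of the
    rule are the ones required there.\<close>
  then show ?thesis
    unfolding Abs_T(1)
    using assms(3) new_var_not_labelled[OF Abs_T(7)[unfolded Abs_T(2)]] Abs_T(3-6)
    by (intro state_ok_eliminate[OF _ _ subst_var_hsingle])
      (auto simp: Abs_T(2) side_matches_simps equiv_hedge_simps equiv_iffs simp del: aup_ok.simps state_ok.simps)
next
  case Sol_T
  then show ?thesis
    using state_ok_solve assms(2,3) by blast
next
  case Sol_H
  then show ?thesis
    using state_ok_solve assms(2,3) by blast
next
  case (Mer_I x\<^sub>1 l\<^sub>1 r\<^sub>1 S x\<^sub>2 l\<^sub>2 r\<^sub>2 \<pi> \<tau> P \<Gamma> \<sigma>)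
  \<comment> \<open>The surviving problem is counted as part of the unchanged remainder, so that
    adding it again in \<open>state_ok_rename\<close> has no effect.\<close>
  have ok: "state_ok A \<Delta> \<xi> l r (P, insert (IVar x\<^sub>2, l\<^sub>2, r\<^sub>2) (insert (IVar x\<^sub>1, l\<^sub>1, r\<^sub>1) S), \<Gamma>, \<sigma>)"
    using assms(3) by (simp only: Mer_I(1) insert_commute insert_is_Un[symmetric] Un_insert_left Un_empty_left)
  have \<tau>: "subst_var \<tau> = (susp 1)(IVar x\<^sub>2 := susp \<pi> (IVar x\<^sub>1))"
    by (simp only: Mer_I(9) subst_var_isingle)
  have "inj_on fst (P \<union> insert (IVar x\<^sub>1, l\<^sub>1, r\<^sub>1) (insert (IVar x\<^sub>1, l\<^sub>1, r\<^sub>1) S))"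
    using ok by (auto elim: inj_on_subset)
  then show ?thesis
    using state_ok_rename[OF ok _ \<tau> Mer_I(6) _ _ _ Mer_I(7,8)] ok Mer_I(4,5)
    unfolding Mer_I(2) by auto
next
  case (Mer_H \<chi>\<^sub>1 l\<^sub>1 r\<^sub>1 S X\<^sub>2 l\<^sub>2 r\<^sub>2 \<pi> \<tau> P \<Gamma> \<sigma>)
  have ok: "state_ok A \<Delta> \<xi> l r (P, insert (HVar X\<^sub>2, l\<^sub>2, r\<^sub>2) (insert (\<chi>\<^sub>1, l\<^sub>1, r\<^sub>1) S), \<Gamma>, \<sigma>)"
    using assms(3) by (simp only: Mer_H(1) insert_commute insert_is_Un[symmetric] Un_insert_left Un_empty_left)
  have \<tau>: "subst_var \<tau> = (susp 1)(HVar X\<^sub>2 := susp \<pi> \<chi>\<^sub>1)"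
    by (simp only: Mer_H(9) subst_var_hsingle)
  have "inj_on fst (P \<union> insert (\<chi>\<^sub>1, l\<^sub>1, r\<^sub>1) (insert (\<chi>\<^sub>1, l\<^sub>1, r\<^sub>1) S))"
    using ok by (auto elim: inj_on_subset)
  then show ?thesis
    using state_ok_rename[OF ok _ \<tau> Mer_H(6) _ _ _ Mer_H(7,8)] ok Mer_H(4,5)
    unfolding Mer_H(2) by auto
next
  case (Nar_T P X t\<^sub>1 t\<^sub>2 S \<Gamma> \<sigma> x \<tau>)
  have ok: "state_ok A \<Delta> \<xi> l r (P, insert (HVar X, [Term t\<^sub>1], [Term t\<^sub>2]) S, \<Gamma>, \<sigma>)"
    using assms(3) unfolding Nar_T(2) .
  \<comment> \<open>Narrowing is a renaming along the identity permutation; the conditions on the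
    sides become instances of reflexivity.\<close>
  have \<tau>: "subst_var \<tau> = (susp 1)(HVar X := susp 1 (IVar x))"
    by (simp add: Nar_T(5) subst_var_hsingle)
  have new: "IVar x \<notin> fst ` (P \<union> insert (HVar X, [Term t\<^sub>1], [Term t\<^sub>2]) S)"
    using new_var_not_labelled[OF Nar_T(4)[unfolded Nar_T(2)]] .
  have "inj_on fst (P \<union> S)"
    using ok by (auto elim: inj_on_subset)
  then have inj: "inj_on fst (P \<union> insert (IVar x, [Term t\<^sub>1], [Term t\<^sub>2]) S)"
    using new by (auto simp: image_Un)
  have "(IVar x, [Term t\<^sub>1], [Term t\<^sub>2]) \<notin> P"
    using new by force
  moreover have "aup_ok A (IVar x, [Term t\<^sub>1], [Term t\<^sub>2])"
    using ok by simp
  moreover have "based_perm A 1"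
    by (simp add: based_perm_def)
  ultimately show ?thesis
    using state_ok_rename[OF ok Nar_T(3) \<tau> _ inj] unfolding Nar_T(1)
    by (simp add: equiv_hedge_refl del: state_ok.simps)
qed

section \<open>From the invariant at a final state to generalizations\<close>

lemma matching_subst_exists:
  assumes "finite S" "inj_on fst S" "\<forall>p\<in>S. aup_ok A p" and sd: "sd = fst \<or> sd = snd"
  shows "\<exists>\<theta>. is_subst \<theta> \<and> (\<forall>(\<chi>, p)\<in>S. subst_var \<theta> \<chi> = sd p)"
proof -
  \<comment> \<open>Since labels are distinct, a label determines its problem, and \<open>h\<close>
    reads off the selected side.\<close>
  define h where "h \<chi> = sd (snd (the_inv_into S fst \<chi>))" for \<chi>
  have h: "h \<chi> = sd p" if "(\<chi>, p) \<in> S" for \<chi> p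
    using the_inv_into_f_f[OF assms(2) that] by (simp add: h_def)
  \<comment> \<open>At an individual label \<open>aup_ok\<close> guarantees the single term picked
    by \<open>THE\<close>. The identity elsewhere keeps the domain finite.\<close>
  define \<theta> where "\<theta> =
    ((\<lambda>x. if IVar x \<in> fst ` S then (THE t. h (IVar x) = [Term t]) else ISusp 1 x),
     (\<lambda>X. if HVar X \<in> fst ` S then h (HVar X) else [HSusp 1 X]))"
  have ok: "proper_hedge (sd p)" "\<forall>x. \<chi> = IVar x \<longrightarrow> (\<exists>t. sd p = [Term t])" if "(\<chi>, p) \<in> S" for \<chi> p
    using bspec[OF assms(3) that] sd by (cases p; auto)+
  have \<theta>: "subst_var \<theta> \<chi> = sd p" if p: "(\<chi>, p) \<in> S" for \<chi> p
  proof (cases \<chi>)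
    case (IVar x)
    then obtain t where "sd p = [Term t]"
      using ok(2)[OF p] by blast
    then show ?thesis
      using p h[OF p] IVar by (force simp: \<theta>_def)
  next
    case (HVar X)
    then show ?thesis
      using p h[OF p] by (force simp: \<theta>_def)
  qed
  have other: "subst_var \<theta> \<chi> = susp 1 \<chi>" if "\<chi> \<notin> fst ` S" for \<chi>
    using that by (cases \<chi>) (auto simp: \<theta>_def)
  have "subst_dom \<theta> \<subseteq> fst ` S"
    using other by (auto simp: subst_dom_def)
  moreover have "proper_hedge (subst_var \<theta> \<chi>)" for \<chi>
  proof (cases "\<chi> \<in> fst ` S")
    case True
    then show ?thesis using \<theta> ok(1) by fastforce
  qed (simp add: other)
  ultimately have "is_subst \<theta>"
    using assms(1) by (auto simp: is_subst_def dest: finite_subset)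
  with \<theta> show ?thesis by blast
qed

lemma more_general_if_sound:
  assumes "finite S" "inj_on fst S" "\<forall>p\<in>S. aup_ok A p" "sd = fst \<or> sd = snd"
    and "side_sound \<Delta> sd S \<Gamma> s u" "finite \<Delta>"
  shows "more_general (\<Gamma>, s) (\<Delta>, u)"
proof -
  obtain \<theta> where \<theta>: "is_subst \<theta>" "\<forall>(\<chi>, p)\<in>S. subst_var \<theta> \<chi> = sd p"
    using matching_subst_exists[OF assms(1-4)] by blast
  then have "side_matches \<Delta> sd S \<theta>"
    by (auto simp: side_matches_def equiv_hedge_refl)
  then have "equiv_hedge \<Delta> (subst_hedge \<theta> s) u" "satisfies_under \<Delta> \<Gamma> \<theta>"
    using assms(5) unfolding side_sound_def by blast+
  \<comment> \<open>\<open>\<Delta>\<close> itself is the finite context that witnesses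
    \<open>respects_ctx\<close>, and the least such context lies below it.\<close>
  then show ?thesis
    unfolding more_general_def respects_ctx_def fst_conv snd_conv
    using \<theta>(1) assms(6) subst_ctx_subset[of \<Delta> \<Gamma> \<theta>] by blast
qed

theorem theorem2:
  fixes A :: "'a::{countable, infinite} set"
    and l r :: "('a, 'f::countable, 'v::{countable, infinite}, 'w::{countable, infinite}) hedge"
    and \<Delta> \<Gamma> :: "('a, 'v, 'w) fctx"
    and X :: 'w
    and S :: "('a, 'f, 'v, 'w) aup set"
    and \<sigma> :: "('a, 'f, 'v, 'w) subst"
  assumes "finite A"
    and "proper_hedge l" and "proper_hedge r" and "finite \<Delta>"
    and "based_hedge A l" and "based_hedge A r" and "based_ctx A \<Delta>"
    and "HVar X \<notin> vars_hedge l \<union> vars_hedge r \<union> vars_ctx \<Delta>"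
    and "(vnau A \<Delta>)\<^sup>+\<^sup>+ ({(HVar X, l, r)}, {}, {}, subst_id) ({}, S, \<Gamma>, \<sigma>)"
  shows "based_tic A (\<Gamma>, subst_var \<sigma> (HVar X)) \<and>
    is_generalization (\<Gamma>, subst_var \<sigma> (HVar X)) (\<Delta>, l) (\<Delta>, r)"
proof -
  \<comment> \<open>Initially \<open>X\<close> is mapped to itself and there are no constraints, so
    the matching condition on the only problem is literally the soundness claim.\<close>
  have "state_ok A \<Delta> (HVar X) l r ({(HVar X, l, r)}, {}, {}, subst_id)"
    using assms(2,3,5,6)
    by (simp add: subst_id_def side_sound_def side_matches_def satisfies_under_def
        vars_ctx_def based_ctx_def atoms_ctx_def)
  with assms(9) have "state_ok A \<Delta> (HVar X) l r ({}, S, \<Gamma>, \<sigma>)"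
    by (induction rule: tranclp_induct) (blast intro: state_ok_vnau[OF _ assms(1)])+
  \<comment> \<open>With no unsolved problems left, the invariant is soundness relative to
    \<open>S\<close> alone, once for each side.\<close>
  then show ?thesis
    using more_general_if_sound[of S A fst] more_general_if_sound[of S A snd] assms(4)
    by (auto simp: based_tic_def is_generalization_def is_tic_def)
qed

end
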